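(* Let $\Theta=(\Theta_1,\dots,\Theta_N)$ be an $N$-tuple of pairwise commuting symmetric positive definite $n\times n$ matrices. An $\mathbb{R}^n$-valued field $X=(X_t)_{t\in\mathbb{Z}^N}$ is stationary if and only if (i) for every $j\in\{1,\dots,N\}$ and all $t_1,\dots,t_{j-1},t_{j+1},\dots,t_N\in\mathbb{Z}$, $e^{m\Theta_j}X_{t_1,\dots,t_{j-1},m,t_{j+1},\dots,t_N}\to0$ in probability as $m\to-\infty$; and (ii) $X_t=\sum_{i\in\{0,1\}^N,\,i\ne\mathbf 0}(-1)^{1+i_1+\dots+i_N}e^{-i\ast\Theta}X_{t_1-i_1,\dots,t_N-i_N}+\Delta_tG$ for all $t\in\mathbb{Z}^N$, for some $G\in\mathcal{G}_{\Theta,0}$. Moreover, in this case $G$ is unique and the fields are related by $X=(\mathcal{L}^{-1}_\Theta\circ\mathcal{M}^{-1}_\Theta)(G)$ and $G=(\mathcal{M}_\Theta\circ\mathcal{L}_\Theta)(X)$.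
   Context: $t\ast\Theta=\sum_{j=1}^N t_j\Theta_j$. Equality in law of fields means equality of all finite-dimensional distributions. $X$ is stationary if $(X_{t+s})_t$ and $(X_t)_t$ are equal in law for every $s\in\mathbb{Z}^N$. For a field $Z=(Z_t)_{t\in\mathbb{Z}^N}$, $\Delta_t Z=\sum_{i\in\{0,1\}^N}(-1)^{i_1+\dots+i_N}Z_{t_1-i_1,\dots,t_N-i_N}$; for a field $Y=(Y_{e^t})_{t\in\mathbb{Z}^N}$, $\Delta_tY=\sum_{i\in\{0,1\}^N}(-1)^{i_1+\dots+i_N}Y_{e^{t-i}}$. $G$ is a stationary increment field if $(\Delta_{t+s}G)_{t}$ and $(\Delta_tG)_{t}$ are equal in law for every $s$. $\mathcal{G}_\Theta$ is the class of stationary increment fields $G$ such that $\sum_{j=-\infty}^te^{j\ast\Theta}\Delta_jG:=\lim_{M_1\to\infty}\cdots\lim_{M_N\to\infty}\sum_{j_1=-M_1}^{t_1}\cdots\sum_{j_N=-M_N}^{t_N}e^{j\ast\Theta}\Delta_jG$ converges in probability for every $t$; $\mathcal{G}_{\Theta,0}$ is the subclass with $G_t=0$ a.s. whenever $t_l=0$ for some $l$. Transformations: $(\mathcal{L}_\Theta X)_{e^t}=e^{t\ast\Theta}X_t$, $(\mathcal{L}^{-1}_\Theta Y)_t=e^{-t\ast\Theta}Y_{e^t}$, $(\mathcal{M}^{-1}_\Theta G)_{e^t}=\sum_{j=-\infty}^te^{j\ast\Theta}\Delta_jG$, and $(\mathcal{M}_\Theta Y)_t=(-1)^{|\{l:t_l<0\}|}\sum_j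 e^{-j\ast\Theta}\Delta_jY$, where the sum runs over $j\in\mathbb{Z}^N$ with $1\le j_l\le t_l$ if $t_l\ge0$ and $t_l+1\le j_l\le0$ if $t_l<0$. *)

theory Defs
  imports "HOL-Analysis.Analysis" "HOL-Probability.Probability"
begin

text \<open>Conventions. Multi-indices t in Z^N are represented as functions nat => int
  that vanish outside {0..<N} (coordinate l of the paper is index l-1 here).
  Vectors of R^n are real^'n and n x n matrices are real^'n^'n.
  Random fields are families of functions on the sample space of a probability space M.\<close>

definition ZN :: "nat \<Rightarrow> (nat \<Rightarrow> int) set" where
  "ZN N = {t. \<forall>k\<ge>N. t k = 0}"

definition cube :: "nat \<Rightarrow> (nat \<Rightarrow> int) set" where
  "cube N = {i. \<forall>k. (k < N \<longrightarrow> i k \<in> {0,1}) \<and> (N \<le> k \<longrightarrow> i k = 0)}"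

fun mpow :: "real^'n^'n \<Rightarrow> nat \<Rightarrow> real^'n^'n" where
  "mpow A 0 = mat 1"
| "mpow A (Suc k) = A ** mpow A k"

definition mexp :: "real^'n^'n \<Rightarrow> real^'n^'n" where
  "mexp A = (\<Sum>k. (1 / (fact k :: real)) *\<^sub>R mpow A k)"

definition pos_def :: "real^'n^'n \<Rightarrow> bool" where
  "pos_def A \<longleftrightarrow> (\<forall>x. x \<noteq> 0 \<longrightarrow> x \<bullet> (A *v x) > 0)"

definition tstar :: "nat \<Rightarrow> (nat \<Rightarrow> real^'n^'n) \<Rightarrow> (nat \<Rightarrow> int) \<Rightarrow> real^'n^'n" where
  "tstar N \<Theta> t = (\<Sum>k<N. of_int (t k) *\<^sub>R \<Theta> k)"

text \<open>Rectangular increment Delta_t Z (same formula for fields indexed by e^t).\<close>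
definition Delta :: "nat \<Rightarrow> ((nat \<Rightarrow> int) \<Rightarrow> 'a \<Rightarrow> real^'n) \<Rightarrow> (nat \<Rightarrow> int) \<Rightarrow> 'a \<Rightarrow> real^'n" where
  "Delta N Z t = (\<lambda>\<omega>. \<Sum>i\<in>cube N. ((-1::real) ^ nat (\<Sum>k<N. i k)) *\<^sub>R Z (\<lambda>k. t k - i k) \<omega>)"

definition conv_in_prob :: "'a measure \<Rightarrow> ('i \<Rightarrow> 'a \<Rightarrow> 'b::metric_space) \<Rightarrow> ('a \<Rightarrow> 'b) \<Rightarrow> 'i filter \<Rightarrow> bool" where
  "conv_in_prob M Y L F \<longleftrightarrow>
     (\<forall>m. Y m \<in> borel_measurable M) \<and> L \<in> borel_measurable M \<and>
     (\<forall>e>0. ((\<lambda>m. measure M {\<omega>\<in>space M. dist (Y m \<omega>) (L \<omega>) > e}) \<longlongrightarrow> 0) F)"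

text \<open>Iterated limit in probability
  lim_{M_1 -> oo} ... lim_{M_k -> oo} F(M_1,...,M_k) = L  (M_1 outermost),
  where F takes the vector of cut-offs (M_1 stored at index 0).\<close>
fun ilim :: "'a measure \<Rightarrow> nat \<Rightarrow> ((nat \<Rightarrow> int) \<Rightarrow> 'a \<Rightarrow> 'b::metric_space) \<Rightarrow> ('a \<Rightarrow> 'b) \<Rightarrow> bool" where
  "ilim M 0 F L = (AE \<omega> in M. F (\<lambda>_. 0) \<omega> = L \<omega>)"
| "ilim M (Suc k) F L =
     (\<exists>Y. conv_in_prob M Y L at_top \<and>
          (\<forall>m. ilim M k (\<lambda>Ms. F (\<lambda>l. if l = 0 then m else Ms (l - 1))) (Y m)))"

definition same_law :: "'a measure \<Rightarrow> nat \<Rightarrow> ((nat \<Rightarrow> int) \<Rightarrow> 'a \<Rightarrow> 'b::topological_space)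
    \<Rightarrow> ((nat \<Rightarrow> int) \<Rightarrow> 'a \<Rightarrow> 'b) \<Rightarrow> bool" where
  "same_law M N Z1 Z2 \<longleftrightarrow>
     (\<forall>J. finite J \<and> J \<subseteq> ZN N \<longrightarrow>
        distr M (PiM J (\<lambda>_. borel)) (\<lambda>\<omega>. restrict (\<lambda>t. Z1 t \<omega>) J)
      = distr M (PiM J (\<lambda>_. borel)) (\<lambda>\<omega>. restrict (\<lambda>t. Z2 t \<omega>) J))"

definition stationary :: "'a measure \<Rightarrow> nat \<Rightarrow> ((nat \<Rightarrow> int) \<Rightarrow> 'a \<Rightarrow> 'b::topological_space) \<Rightarrow> bool" where
  "stationary M N X \<longleftrightarrow> (\<forall>s\<in>ZN N. same_law M N (\<lambda>t. X (\<lambda>k. t k + s k)) X)"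

definition stat_incr :: "'a measure \<Rightarrow> nat \<Rightarrow> ((nat \<Rightarrow> int) \<Rightarrow> 'a \<Rightarrow> real^'n) \<Rightarrow> bool" where
  "stat_incr M N G \<longleftrightarrow>
     (\<forall>s\<in>ZN N. same_law M N (\<lambda>t. Delta N G (\<lambda>k. t k + s k)) (\<lambda>t. Delta N G t))"

definition lowbox :: "nat \<Rightarrow> (nat \<Rightarrow> int) \<Rightarrow> (nat \<Rightarrow> int) \<Rightarrow> (nat \<Rightarrow> int) set" where
  "lowbox N Ms t = {j\<in>ZN N. \<forall>l<N. - Ms l \<le> j l \<and> j l \<le> t l}"

definition partsum :: "nat \<Rightarrow> (nat \<Rightarrow> real^'n^'n) \<Rightarrow> ((nat \<Rightarrow> int) \<Rightarrow> 'a \<Rightarrow> real^'n)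
    \<Rightarrow> (nat \<Rightarrow> int) \<Rightarrow> (nat \<Rightarrow> int) \<Rightarrow> 'a \<Rightarrow> real^'n" where
  "partsum N \<Theta> G t Ms = (\<lambda>\<omega>. \<Sum>j\<in>lowbox N Ms t. mexp (tstar N \<Theta> j) *v Delta N G j \<omega>)"

definition inG :: "'a measure \<Rightarrow> nat \<Rightarrow> (nat \<Rightarrow> real^'n^'n) \<Rightarrow> ((nat \<Rightarrow> int) \<Rightarrow> 'a \<Rightarrow> real^'n) \<Rightarrow> bool" where
  "inG M N \<Theta> G \<longleftrightarrow>
     (\<forall>t\<in>ZN N. G t \<in> borel_measurable M) \<and> stat_incr M N G \<and>
     (\<forall>t\<in>ZN N. \<exists>L. ilim M N (partsum N \<Theta> G t) L)"

definition inG0 :: "'a measure \<Rightarrow> nat \<Rightarrow> (nat \<Rightarrow> real^'n^'n) \<Rightarrow> ((nat \<Rightarrow> int) \<Rightarrow> 'a \<Rightarrow> real^'n) \<Rightarrow> bool" where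
  "inG0 M N \<Theta> G \<longleftrightarrow> inG M N \<Theta> G \<and>
     (\<forall>t\<in>ZN N. (\<exists>l<N. t l = 0) \<longrightarrow> (AE \<omega> in M. G t \<omega> = 0))"

text \<open>(L_Theta X)_{e^t} = e^{t*Theta} X_t  (indexed by t).\<close>
definition Lmap :: "nat \<Rightarrow> (nat \<Rightarrow> real^'n^'n) \<Rightarrow> ((nat \<Rightarrow> int) \<Rightarrow> 'a \<Rightarrow> real^'n) \<Rightarrow> (nat \<Rightarrow> int) \<Rightarrow> 'a \<Rightarrow> real^'n" where
  "Lmap N \<Theta> X t = (\<lambda>\<omega>. mexp (tstar N \<Theta> t) *v X t \<omega>)"

text \<open>Y = M^{-1}_Theta G  (Y_{e^t} stored at index t): the iterated limits of partial sums.\<close>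
definition Minv_rel :: "'a measure \<Rightarrow> nat \<Rightarrow> (nat \<Rightarrow> real^'n^'n) \<Rightarrow> ((nat \<Rightarrow> int) \<Rightarrow> 'a \<Rightarrow> real^'n)
    \<Rightarrow> ((nat \<Rightarrow> int) \<Rightarrow> 'a \<Rightarrow> real^'n) \<Rightarrow> bool" where
  "Minv_rel M N \<Theta> G Y \<longleftrightarrow> (\<forall>t\<in>ZN N. ilim M N (partsum N \<Theta> G t) (Y t))"

definition mbox :: "nat \<Rightarrow> (nat \<Rightarrow> int) \<Rightarrow> (nat \<Rightarrow> int) set" where
  "mbox N t = {j\<in>ZN N. \<forall>l<N. (0 \<le> t l \<longrightarrow> 1 \<le> j l \<and> j l \<le> t l) \<and>
                               (t l < 0 \<longrightarrow> t l + 1 \<le> j l \<and> j l \<le> 0)}"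

definition Mmap :: "nat \<Rightarrow> (nat \<Rightarrow> real^'n^'n) \<Rightarrow> ((nat \<Rightarrow> int) \<Rightarrow> 'a \<Rightarrow> real^'n) \<Rightarrow> (nat \<Rightarrow> int) \<Rightarrow> 'a \<Rightarrow> real^'n" where
  "Mmap N \<Theta> Y t = (\<lambda>\<omega>. ((-1::real) ^ card {l. l < N \<and> t l < 0}) *\<^sub>R
      (\<Sum>j\<in>mbox N t. mexp (- tstar N \<Theta> j) *v Delta N Y j \<omega>))"

definition cond_i :: "'a measure \<Rightarrow> nat \<Rightarrow> (nat \<Rightarrow> real^'n^'n) \<Rightarrow> ((nat \<Rightarrow> int) \<Rightarrow> 'a \<Rightarrow> real^'n) \<Rightarrow> bool" where
  "cond_i M N \<Theta> X \<longleftrightarrow>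
     (\<forall>j<N. \<forall>t\<in>ZN N.
        conv_in_prob M (\<lambda>m::int. \<lambda>\<omega>. mexp (of_int m *\<^sub>R \<Theta> j) *v X (t(j := m)) \<omega>) (\<lambda>_. 0) at_bot)"

definition cond_ii :: "'a measure \<Rightarrow> nat \<Rightarrow> (nat \<Rightarrow> real^'n^'n) \<Rightarrow> ((nat \<Rightarrow> int) \<Rightarrow> 'a \<Rightarrow> real^'n)
    \<Rightarrow> ((nat \<Rightarrow> int) \<Rightarrow> 'a \<Rightarrow> real^'n) \<Rightarrow> bool" where
  "cond_ii M N \<Theta> X G \<longleftrightarrow>
     (\<forall>t\<in>ZN N. AE \<omega> in M. X t \<omega> =
        (\<Sum>i\<in>cube N - {\<lambda>_. 0}. ((-1::real) ^ nat (1 + (\<Sum>k<N. i k))) *\<^sub>R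
            (mexp (- tstar N \<Theta> i) *v X (\<lambda>k. t k - i k) \<omega>)) + Delta N G t \<omega>)"

end

theory Submission
  imports Defs
begin

text \<open>
  Put \<open>Y\<^sub>t = e\<^bsup>t*\<Theta>\<^esup> X\<^sub>t\<close>. Multiplying the autoregression (ii) by \<open>e\<^bsup>t*\<Theta>\<^esup>\<close> turns it into
  \<open>\<Delta>\<^sub>t Y = e\<^bsup>t*\<Theta>\<^esup> \<Delta>\<^sub>t G\<close>, so sums of \<open>e\<^bsup>j*\<Theta>\<^esup> \<Delta>\<^sub>j G\<close> over boxes telescope to alternating sums of \<open>Y\<close> over
  the corners. Condition (i) says that \<open>Y\<close> vanishes in probability when a coordinate tends to
  minus infinity, hence the iterated limit of the box sums ending at \<open>t\<close> is \<open>Y\<^sub>t\<close>. Conversely,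
  \<open>G\<close> is recovered by summing its increments from the axes, where it vanishes.

  If \<open>X\<close> is stationary, (i) follows from tightness and the exponential decay of \<open>e\<^bsup>m\<Theta>\<^esup>\<close> as
  \<open>m\<close> tends to minus infinity, and \<open>\<Delta>G\<close> is a finite linear filter of \<open>X\<close>, hence stationary.
  Conversely, \<open>X\<close> and each of its shifts are limits in probability of the same linear filters of
  \<open>\<Delta>G\<close> and of its shift, which agree in law.
\<close>

section \<open>The matrix exponential\<close>

text \<open>Symmetry and positive definiteness enter through one inequality, |e^\<Theta>_j x| >= (1
  + c) |x|, obtained from quadratic forms rather than by simultaneous diagonalization. Commutativity
  gives the group law e^(s*\<Theta>) e^(t*\<Theta>) = e^((s+t)*\<Theta>) on which the passage
  between X and Y rests. The obstacle in several dimensions is the 2^N corners of a box. They are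
  produced one coordinate at a time, each step being a one-dimensional telescoping sum; the error of
  each step is a difference of corners in which one coordinate recedes, which matches the order of
  an iterated limit. For the converse, two laws have to be compared at finitely many points at once.
  One finite lower corner is fixed, far enough down for all these points and for both X and its
  shift. The two vectors of box sums are then images of \<Delta>G and of its shift under literally
  the same linear map.\<close>

lemma matrix_add_distrib_right: "(A + B) ** C = A ** C + B ** (C::real^'n^'n)"
  by (simp add: matrix_matrix_mult_def vec_eq_iff algebra_simps sum.distrib)

lemma scaleR_matrix_mult_left: "(c *\<^sub>R A) ** B = c *\<^sub>R (A ** (B::real^'n^'n))"
  by (simp add: scalar_matrix_assoc)

lemma scaleR_matrix_mult_right: "A ** (c *\<^sub>R B) = c *\<^sub>R (A ** (B::real^'n^'n))"
  by (simp add: scalar_matrix_assoc matrix_scalar_ac)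

lemma sum_matrix_mult: "(\<Sum>i\<in>I. f i) ** B = (\<Sum>i\<in>I. f i ** (B::real^'n^'n))" for f :: "'i \<Rightarrow> real^'n^'n"
  by (induction I rule: infinite_finite_induct) (auto simp: matrix_add_distrib_right)

lemma matrix_mult_sum: "B ** (\<Sum>i\<in>I. f i) = (\<Sum>i\<in>I. (B::real^'n^'n) ** f i)" for f :: "'i \<Rightarrow> real^'n^'n"
  by (induction I rule: infinite_finite_induct) (auto simp: matrix_add_ldistrib)

lemma mpow_commute:
  assumes "A ** B = B ** A"
  shows "B ** mpow A k = mpow A k ** B"
proof (induction k)
  case (Suc k)
  have "B ** (A ** mpow A k) = A ** (B ** mpow A k)"
    using assms by (simp add: matrix_mul_assoc)
  then show ?case using Suc by (simp add: matrix_mul_assoc)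
qed simp

lemma norm_mpow_mult_le:
  fixes A :: "real^'n^'n"
  shows "norm (mpow A k *v x) \<le> onorm ((*v) A) ^ k * norm x"
proof (induction k)
  case (Suc k)
  have "norm (mpow A (Suc k) *v x) = norm (A *v (mpow A k *v x))"
    by (simp add: matrix_vector_mul_assoc)
  also have "\<dots> \<le> onorm ((*v) A) * norm (mpow A k *v x)"
    by (rule onorm) simp
  also have "\<dots> \<le> onorm ((*v) A) * (onorm ((*v) A) ^ k * norm x)"
    using Suc by (intro mult_left_mono onorm_pos_le) auto
  finally show ?case by (simp add: mult.assoc)
qed simp

lemma mpow_entry_le:
  fixes A :: "real^'n^'n"
  shows "\<bar>mpow A k $ i $ j\<bar> \<le> onorm ((*v) A) ^ k"
proof -
  have "mpow A k $ i $ j = (mpow A k *v axis j 1) $ i"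
    by (simp add: matrix_vector_mult_basis column_def)
  then have "\<bar>mpow A k $ i $ j\<bar> \<le> norm (mpow A k *v axis j 1)"
    by (simp add: component_le_norm_cart)
  also have "\<dots> \<le> onorm ((*v) A) ^ k * norm (axis j (1::real))" by (rule norm_mpow_mult_le)
  finally show ?thesis by (simp add: norm_axis_1)
qed

lemma summable_exp_bound: "summable (\<lambda>k. \<bar>1 / fact k\<bar> * (c::real) ^ k)"
  using summable_exp[of c] by (simp add: divide_inverse)

lemma summable_mpow_entry:
  fixes A :: "real^'n^'n"
  shows "summable (\<lambda>k. \<bar>mpow A k $ i $ j / fact k\<bar>)"
proof (rule summable_comparison_test')
  show "norm \<bar>mpow A k $ i $ j / fact k\<bar> \<le> \<bar>1 / fact k\<bar> * onorm ((*v) A) ^ k" for k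
    using mpow_entry_le[of A k i j] by (simp add: divide_simps)
qed (rule summable_exp_bound)

text \<open>\<open>mexp\<close> is a \<open>suminf\<close>, which says nothing before convergence is
  known. Domination of every entry by a scalar exponential series gives it, and later identities can
  be read off absolutely convergent real series.\<close>

lemma mexp_entry_sums:
  fixes A :: "real^'n^'n"
  shows "(\<lambda>k. mpow A k $ i $ j / fact k) sums (mexp A $ i $ j)"
proof -
  let ?T = "\<lambda>k. (1 / (fact k :: real)) *\<^sub>R mpow A k"
  have "?T sums (\<chi> i j. \<Sum>k. mpow A k $ i $ j / fact k)"
    unfolding sums_def
  proof (intro vec_tendstoI)
    fix i j
    have "(\<lambda>k. mpow A k $ i $ j / fact k) sums (\<Sum>k. mpow A k $ i $ j / fact k)"
      by (intro summable_sums summable_rabs_cancel[OF summable_mpow_entry])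
    then show "((\<lambda>n. (\<Sum>k<n. ?T k) $ i $ j) \<longlongrightarrow> (\<chi> i j. \<Sum>k. mpow A k $ i $ j / fact k) $ i $ j) sequentially"
      by (simp add: sums_def)
  qed
  then have "mexp A = (\<chi> i j. \<Sum>k. mpow A k $ i $ j / fact k)"
    unfolding mexp_def by (rule sums_unique[symmetric])
  then show ?thesis
    by (simp add: summable_sums summable_rabs_cancel[OF summable_mpow_entry])
qed

lemma mexp_0: "mexp (0::real^'n^'n) = mat 1"
proof -
  have "(\<lambda>k. (1 / (fact k :: real)) *\<^sub>R mpow (0::real^'n^'n) k) sums (mat 1)"
  proof -
    have "mpow (0::real^'n^'n) k = (if k = 0 then mat 1 else 0)" for k by (cases k) auto
    then have "(\<lambda>k. (1 / (fact k :: real)) *\<^sub>R mpow (0::real^'n^'n) k) = (\<lambda>k. if k = 0 then mat 1 else 0)"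
      by (auto simp: fun_eq_iff)
    then show ?thesis using sums_single[of 0 "\<lambda>_. mat 1 :: real^'n^'n"] by simp
  qed
  then show ?thesis by (simp add: mexp_def sums_iff)
qed

text \<open>The binomial theorem normalized by factorials: with T C n = C^n / n! the coefficients
  disappear and the right-hand side is the diagonal sum of a Cauchy product. The induction uses C
  T_n = (n + 1) T_(n+1) on each factor, \<open>comm\<close> moving B past the powers of A.\<close>

lemma mpow_add_commuting:
  fixes A B :: "real^'n^'n"
  assumes AB: "A ** B = B ** A"
  defines "T \<equiv> \<lambda>A n. (1 / (fact n :: real)) *\<^sub>R mpow (A::real^'n^'n) n"
  shows "T (A + B) n = (\<Sum>i\<le>n. T A i ** T B (n - i))"
proof (induction n)
  case 0
  show ?case by (simp add: T_def)
next
  case (Suc n)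
  have step: "C ** T C n = real (Suc n) *\<^sub>R T C (Suc n)" for C n
    by (simp add: T_def scaleR_matrix_mult_left scaleR_matrix_mult_right flip: of_nat_Suc)
  have comm: "B ** T A i = T A i ** B" for i
    using mpow_commute[OF AB, of i] by (simp add: T_def scaleR_matrix_mult_left scaleR_matrix_mult_right)
  have "real (Suc n) *\<^sub>R T (A + B) (Suc n) = (A + B) ** (\<Sum>i\<le>n. T A i ** T B (n - i))"
    by (metis step Suc)
  also have "\<dots> = (\<Sum>i\<le>n. (A ** T A i) ** T B (n - i)) + (\<Sum>i\<le>n. T A i ** (B ** T B (n - i)))"
    by (simp add: matrix_add_distrib_right matrix_mult_sum matrix_mul_assoc comm sum.distrib)
  also have "\<dots> = (\<Sum>i\<le>n. real (Suc i) *\<^sub>R (T A (Suc i) ** T B (n - i))) +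
      (\<Sum>i\<le>n. real (Suc n - i) *\<^sub>R (T A i ** T B (Suc n - i)))"
    by (simp add: step scaleR_matrix_mult_left scaleR_matrix_mult_right Suc_diff_le del: of_nat_Suc)
  \<comment> \<open>The first sum is shifted by one and the second extended by one; both new terms
    have weight 0. The weights i and \<open>Suc n - i\<close> then add up to
    \<open>Suc n\<close>.\<close>
  also have "\<dots> = (\<Sum>i\<le>Suc n. real i *\<^sub>R (T A i ** T B (Suc n - i))) +
      (\<Sum>i\<le>Suc n. real (Suc n - i) *\<^sub>R (T A i ** T B (Suc n - i)))"
    unfolding sum.atMost_Suc_shift[of "\<lambda>i. real i *\<^sub>R (T A i ** T B (Suc n - i))"]
      sum.atMost_Suc[of "\<lambda>i. real (Suc n - i) *\<^sub>R (T A i ** T B (Suc n - i))"] by simp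
  also have "\<dots> = (\<Sum>i\<le>Suc n. real (Suc n) *\<^sub>R (T A i ** T B (Suc n - i)))"
    by (simp only: sum.distrib [symmetric] scaleR_left_distrib [symmetric] of_nat_add [symmetric]) simp
  also have "\<dots> = real (Suc n) *\<^sub>R (\<Sum>i\<le>Suc n. T A i ** T B (Suc n - i))"
    by (simp only: scaleR_right.sum)
  finally show ?case
    unfolding scaleR_cancel_left by (simp del: sum.atMost_Suc)
qed

text \<open>Entrywise Cauchy product: an entry of the matrix product is a finite sum over r of
  products of two absolutely convergent series, whose diagonals are given by the binomial
  formula.\<close>

lemma mexp_add_commuting:
  fixes A B :: "real^'n^'n"
  assumes "A ** B = B ** A"
  shows "mexp (A + B) = mexp A ** mexp B"
proof -
  have "mexp (A + B) $ i $ j = (mexp A ** mexp B) $ i $ j" for i j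
  proof -
    have "(\<lambda>n. \<Sum>r\<in>UNIV. \<Sum>k\<le>n. (mpow A k $ i $ r / fact k) * (mpow B (n - k) $ r $ j / fact (n - k)))
      sums (\<Sum>r\<in>UNIV. mexp A $ i $ r * mexp B $ r $ j)"
    proof (intro sums_sum)
      fix r
      show "(\<lambda>n. \<Sum>k\<le>n. (mpow A k $ i $ r / fact k) * (mpow B (n - k) $ r $ j / fact (n - k)))
        sums (mexp A $ i $ r * mexp B $ r $ j)"
        using Cauchy_product_sums[of "\<lambda>k. mpow A k $ i $ r / fact k" "\<lambda>k. mpow B k $ r $ j / fact k"]
          summable_mpow_entry[of A i r] summable_mpow_entry[of B r j]
          mexp_entry_sums[of A i r] mexp_entry_sums[of B r j] by (simp add: sums_iff)
    qed
    moreover have "(\<Sum>r\<in>UNIV. \<Sum>k\<le>n. (mpow A k $ i $ r / fact k) * (mpow B (n - k) $ r $ j / fact (n - k)))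
        = mpow (A + B) n $ i $ j / fact n" for n
    proof -
      have "mpow (A + B) n $ i $ j / fact n = ((1 / (fact n :: real)) *\<^sub>R mpow (A + B) n) $ i $ j"
        by simp
      also have "\<dots> = (\<Sum>k\<le>n. \<Sum>r\<in>UNIV. (mpow A k $ i $ r / fact k) * (mpow B (n - k) $ r $ j / fact (n - k)))"
        unfolding mpow_add_commuting[OF assms] by (simp add: matrix_matrix_mult_def)
      finally show ?thesis by (subst sum.swap) simp
    qed
    ultimately show ?thesis
      using mexp_entry_sums[of "A + B" i j] by (simp add: sums_iff matrix_matrix_mult_def)
  qed
  then show ?thesis by (simp add: vec_eq_iff)
qed

section \<open>Quadratic forms and norm growth of the exponential\<close>

lemma mexp_quadratic_form_sums:
  fixes A :: "real^'n^'n"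
  shows "(\<lambda>k. (x \<bullet> (mpow A k *v x)) / fact k) sums (x \<bullet> (mexp A *v x))"
proof -
  have "(\<lambda>k. \<Sum>i\<in>UNIV. x $ i * (\<Sum>j\<in>UNIV. (mpow A k $ i $ j / fact k) * x $ j)) sums
     (\<Sum>i\<in>UNIV. x $ i * (\<Sum>j\<in>UNIV. mexp A $ i $ j * x $ j))"
    by (intro sums_sum sums_mult sums_mult2 mexp_entry_sums)
  then show ?thesis
    by (simp add: inner_vec_def matrix_vector_mult_def sum_divide_distrib sum_distrib_left sum_distrib_right)
qed

lemma mpow_add: "mpow A (j + k) = mpow A j ** mpow A k"
  by (induction j) (auto simp: matrix_mul_assoc)

lemma symmetric_inner:
  assumes "transpose A = (A::real^'n^'n)"
  shows "(A *v x) \<bullet> y = x \<bullet> (A *v y)"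
  using assms by (metis dot_lmul_matrix inner_commute transpose_matrix_vector)

lemma transpose_mpow: "transpose A = A \<Longrightarrow> transpose (mpow A k) = mpow (A::real^'n^'n) k"
  by (induction k) (auto simp: matrix_transpose_mul mpow_commute[OF refl])

text \<open>Half of the power is moved across the inner product: for k = 2j symmetry leaves |A^j
  x|^2, for k = 2j + 1 the quadratic form of A at A^j x.\<close>

lemma mpow_quadratic_form_nonneg:
  fixes A :: "real^'n^'n"
  assumes "transpose A = A" "pos_def A"
  shows "0 \<le> x \<bullet> (mpow A k *v x)"
proof -
  have pos: "0 \<le> y \<bullet> (A *v y)" for y
    using assms(2) by (cases "y = 0") (auto simp: pos_def_def less_imp_le)
  define j where "j = k div 2"
  have sq: "x \<bullet> ((mpow A j ** C ** mpow A j) *v x) = (mpow A j *v x) \<bullet> (C *v (mpow A j *v x))" for C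
    by (simp add: symmetric_inner[OF transpose_mpow[OF assms(1)]] matrix_vector_mul_assoc matrix_mul_assoc)
  show ?thesis
  proof (cases "even k")
    case True
    then have "k = j + j" by (auto simp: j_def)
    then have "mpow A k = mpow A j ** mat 1 ** mpow A j" by (simp add: mpow_add)
    then show ?thesis by (simp only: sq) simp
  next
    case False
    then have "k = j + Suc j" by (auto simp: j_def elim!: oddE)
    then have "mpow A k = mpow A j ** A ** mpow A j" by (simp add: mpow_add matrix_mul_assoc mpow_commute[OF refl])
    then show ?thesis by (simp only: sq pos)
  qed
qed

text \<open>The constant is the minimum of the quadratic form on the compact unit sphere, extended
  by homogeneity.\<close>

lemma pos_def_lower_bound:
  fixes A :: "real^'n^'n"
  assumes "pos_def A"
  obtains c where "c > 0" "\<And>x. c * (norm x)\<^sup>2 \<le> x \<bullet> (A *v x)"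
proof -
  have "continuous_on (sphere 0 1) (\<lambda>x. x \<bullet> (A *v x))"
    by (intro continuous_intros linear_continuous_on) auto
  moreover have "sphere (0::real^'n) 1 \<noteq> {}" by auto
  ultimately obtain u where u: "u \<in> sphere 0 1" "\<And>y. y \<in> sphere 0 1 \<Longrightarrow> u \<bullet> (A *v u) \<le> y \<bullet> (A *v y)"
    using continuous_attains_inf[OF compact_sphere, of 0 1 "\<lambda>x. x \<bullet> (A *v x)"] by blast
  show ?thesis
  proof
    show "u \<bullet> (A *v u) > 0" using u(1) assms unfolding pos_def_def by (metis mem_sphere_0 norm_zero zero_neq_one)
    show "(u \<bullet> (A *v u)) * (norm x)\<^sup>2 \<le> x \<bullet> (A *v x)" for x
    proof (cases "x = 0")
      case False
      define y where "y = x /\<^sub>R norm x"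
      have x: "x = norm x *\<^sub>R y" using False by (simp add: y_def)
      have "u \<bullet> (A *v u) \<le> y \<bullet> (A *v y)" using False by (intro u(2)) (simp add: y_def)
      then have "(u \<bullet> (A *v u)) * (norm x)\<^sup>2 \<le> (norm x)\<^sup>2 * (y \<bullet> (A *v y))"
        by (metis mult.commute mult_left_mono zero_le_power2)
      also have "\<dots> = x \<bullet> (A *v x)"
        using arg_cong[OF x, of "\<lambda>z. z \<bullet> (A *v z)"]
        by (simp only: matrix_vector_mult_scaleR power2_eq_square inner_scaleR_left inner_scaleR_right mult.assoc)
      finally show ?thesis .
    qed simp
  qed
qed

text \<open>All terms of the exponential series of \<open>x \<bullet> (mexp A *v x)\<close> are nonnegative; keep the first two.\<close>

lemma mexp_expansive:
  fixes A :: "real^'n^'n"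
  assumes "transpose A = A" "pos_def A"
  obtains c where "c > 0" "\<And>x. (1 + c) * norm x \<le> norm (mexp A *v x)"
proof -
  obtain c where c: "c > 0" "\<And>x. c * (norm x)\<^sup>2 \<le> x \<bullet> (A *v x)"
    using pos_def_lower_bound[OF assms(2)] by blast
  show ?thesis
  proof
    show "(1 + c) * norm x \<le> norm (mexp A *v x)" for x
    proof (cases "x = 0")
      case False
      have "(\<Sum>k<2. (x \<bullet> (mpow A k *v x)) / fact k) \<le> x \<bullet> (mexp A *v x)"
        unfolding sums_unique[OF mexp_quadratic_form_sums[of x A]]
        by (intro sum_le_suminf sums_summable[OF mexp_quadratic_form_sums[of x A]])
          (auto intro!: divide_nonneg_nonneg mpow_quadratic_form_nonneg[OF assms])
      then have "(norm x)\<^sup>2 + x \<bullet> (A *v x) \<le> x \<bullet> (mexp A *v x)"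
        using power2_norm_eq_inner[of x] by (simp add: lessThan_Suc numeral_2_eq_2)
      also have "\<dots> \<le> norm x * norm (mexp A *v x)" by (rule norm_cauchy_schwarz)
      finally have "norm x * ((1 + c) * norm x) \<le> norm x * norm (mexp A *v x)"
        using c(2)[of x] by (simp add: algebra_simps power2_eq_square flip: power2_norm_eq_inner)
      then show ?thesis using False by simp
    qed simp
  qed (rule c)
qed

section \<open>Rectangular increments and box sums\<close>

lemma cube_0: "cube 0 = {\<lambda>_. 0}"
  by (auto simp: cube_def)

lemma cube_Suc: "cube (Suc N) = cube N \<union> (\<lambda>i. i(N := 1)) ` cube N"
proof (intro set_eqI iffI)
  fix i assume i: "i \<in> cube (Suc N)"
  show "i \<in> cube N \<union> (\<lambda>i. i(N := 1)) ` cube N"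
  proof (cases "i N = 0")
    case True
    then have "i \<in> cube N"
      using i by (auto simp: cube_def less_Suc_eq_le le_eq_less_or_eq[of N] Suc_le_eq)
    then show ?thesis by blast
  next
    case False
    then have "i N = 1" using i by (auto simp: cube_def)
    then have "i = (i(N := 0))(N := 1)" "i(N := 0) \<in> cube N"
      using i by (auto simp: cube_def less_Suc_eq_le le_eq_less_or_eq[of N] Suc_le_eq)
    then show ?thesis by blast
  qed
qed (auto simp: cube_def less_Suc_eq)

lemma finite_cube: "finite (cube N)"
  by (induction N) (auto simp: cube_0 cube_Suc)

lemma cube_subset_ZN: "cube N \<subseteq> ZN N"
  by (auto simp: cube_def ZN_def)

lemma cube_sum_nonneg: "i \<in> cube N \<Longrightarrow> 0 \<le> (\<Sum>k<N. i k)"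
  by (rule sum_nonneg) (auto simp: cube_def)

lemma zero_in_cube: "(\<lambda>_. 0) \<in> cube N"
  by (auto simp: cube_def)

text \<open>Splitting the cube by its last coordinate exhibits the increment as a backward
  difference, in direction N, of the lower-dimensional increment. This is the reduction to dimension
  one behind the inductions on N.\<close>

lemma Delta_Suc:
  "Delta (Suc N) Z t \<omega> = Delta N Z t \<omega> - Delta N Z (t(N := t N - 1)) \<omega>"
proof -
  let ?h = "\<lambda>i. ((-1::real) ^ nat (\<Sum>k<Suc N. i k)) *\<^sub>R Z (\<lambda>k. t k - i k) \<omega>"
  have "Delta (Suc N) Z t \<omega> = sum ?h (cube N) + sum ?h ((\<lambda>i. i(N := 1)) ` cube N)"
    unfolding Delta_def cube_Suc
  proof (rule sum.union_disjoint)
    show "cube N \<inter> (\<lambda>i. i(N := 1)) ` cube N = {}"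
      by (auto simp: cube_def fun_upd_def)
  qed (auto simp: finite_cube)
  also have "sum ?h (cube N) = Delta N Z t \<omega>"
    unfolding Delta_def by (rule sum.cong) (auto simp: cube_def)
  also have "sum ?h ((\<lambda>i. i(N := 1)) ` cube N) = (\<Sum>i\<in>cube N. ?h (i(N := 1)))"
  proof (subst sum.reindex)
    show "inj_on (\<lambda>i. i(N := 1)) (cube N)"
    proof (rule inj_onI)
      fix i j :: "nat \<Rightarrow> int" assume *: "i \<in> cube N" "j \<in> cube N" "i(N := 1) = j(N := 1)"
      then have "i N = j N" by (simp add: cube_def)
      with *(3) show "i = j" by (metis fun_upd_triv fun_upd_upd)
    qed
  qed simp
  also have "\<dots> = (\<Sum>i\<in>cube N. - (((-1::real) ^ nat (\<Sum>k<N. i k)) *\<^sub>R Z (\<lambda>k. (t(N := t N - 1)) k - i k) \<omega>))"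
  proof (rule sum.cong[OF refl])
    fix i assume i: "i \<in> cube N"
    have "(\<Sum>k<Suc N. (i(N := 1)) k) = (\<Sum>k<N. i k) + 1" by simp
    then have "(-1::real) ^ nat (\<Sum>k<Suc N. (i(N := 1)) k) = - ((-1) ^ nat (\<Sum>k<N. i k))"
      using cube_sum_nonneg[OF i] by (simp add: nat_add_distrib)
    moreover have "(\<lambda>k. t k - (i(N := 1)) k) = (\<lambda>k. (t(N := t N - 1)) k - i k)"
      using i by (auto simp: fun_eq_iff cube_def)
    ultimately show "?h (i(N := 1)) = - (((-1::real) ^ nat (\<Sum>k<N. i k)) *\<^sub>R Z (\<lambda>k. (t(N := t N - 1)) k - i k) \<omega>)"
      by simp
  qed
  also have "\<dots> = - Delta N Z (t(N := t N - 1)) \<omega>"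
    by (simp add: Delta_def sum_negf)
  finally show ?thesis by simp
qed

lemma Delta_diff: "Delta N (\<lambda>t \<omega>. Z t \<omega> - W t \<omega>) t \<omega> = Delta N Z t \<omega> - Delta N W t \<omega>"
  by (simp add: Delta_def scaleR_diff_right sum_subtractf)

lemma Delta_shift:
  assumes "N \<le> l"
  shows "Delta N (\<lambda>t. Z (t(l := t l + c))) t = Delta N Z (t(l := t l + c))"
  unfolding Delta_def
proof (intro ext sum.cong refl)
  fix \<omega> i assume "i \<in> cube N"
  then have "(\<lambda>k. t k - i k)(l := t l - i l + c) = (\<lambda>k. (t(l := t l + c)) k - i k)"
    using assms by (auto simp: cube_def)
  then show "(- 1) ^ nat (\<Sum>k<N. i k) *\<^sub>R Z ((\<lambda>k. t k - i k)(l := t l - i l + c)) \<omega> =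
           (- 1) ^ nat (\<Sum>k<N. i k) *\<^sub>R Z (\<lambda>k. (t(l := t l + c)) k - i k) \<omega>" by simp
qed

text \<open>Here the difference in direction N is taken first, inside the field, so that an
  induction hypothesis for arbitrary fields applies to the differenced field.\<close>

lemma Delta_Suc':
  "Delta (Suc N) Z t \<omega> = Delta N (\<lambda>t \<omega>. Z t \<omega> - Z (t(N := t N - 1)) \<omega>) t \<omega>"
  using Delta_shift[of N N Z "-1" t] by (simp add: Delta_Suc Delta_diff)

lemma Delta_cong:
  assumes "t \<in> ZN N" "\<And>t. t \<in> ZN N \<Longrightarrow> Z t \<omega> = W t \<omega>"
  shows "Delta N Z t \<omega> = Delta N W t \<omega>"
  unfolding Delta_def
proof (intro sum.cong refl)
  fix i assume "i \<in> cube N"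
  then have "(\<lambda>k. t k - i k) \<in> ZN N" using assms(1) by (auto simp: cube_def ZN_def)
  then show "(- 1) ^ nat (\<Sum>k<N. i k) *\<^sub>R Z (\<lambda>k. t k - i k) \<omega> =
         (- 1) ^ nat (\<Sum>k<N. i k) *\<^sub>R W (\<lambda>k. t k - i k) \<omega>"
    using assms(2) by simp
qed

text \<open>The alternating sum of \<open>Y\<close> over the corners of the box spanned by \<open>a\<close> and \<open>t\<close> in the
  first \<open>k\<close> coordinates.\<close>

primrec corner_diff :: "nat \<Rightarrow> (nat \<Rightarrow> int) \<Rightarrow> ((nat \<Rightarrow> int) \<Rightarrow> 'b) \<Rightarrow> (nat \<Rightarrow> int) \<Rightarrow> 'b::ab_group_add" where
  "corner_diff 0 a Y t = Y t"
| "corner_diff (Suc k) a Y t = corner_diff k a Y t - corner_diff k a Y (t(k := a k))"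

text \<open>Sums are oriented like integrals, \<open>\<integral>\<^sub>a\<^sup>b = - \<integral>\<^sub>b\<^sup>a\<close>; this treats the boxes of both
  transformations, and all signs of the coordinates, uniformly.\<close>

definition oriented_sum :: "int \<Rightarrow> int \<Rightarrow> (int \<Rightarrow> 'b) \<Rightarrow> 'b::ab_group_add" where
  "oriented_sum a b f = (if a \<le> b then (\<Sum>m\<in>{a<..b}. f m) else - (\<Sum>m\<in>{b<..a}. f m))"

primrec box_sum :: "nat \<Rightarrow> (nat \<Rightarrow> int) \<Rightarrow> ((nat \<Rightarrow> int) \<Rightarrow> 'b) \<Rightarrow> (nat \<Rightarrow> int) \<Rightarrow> 'b::ab_group_add" where
  "box_sum 0 a f t = f t"
| "box_sum (Suc k) a f t = oriented_sum (a k) (t k) (\<lambda>m. box_sum k a f (t(k := m)))"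

lemma oriented_sum_step: "oriented_sum a b f - oriented_sum a (b - 1) f = f b"
proof -
  have "{c<..b} = insert b {c<..b - 1}" if "c < b" for c using that by auto
  moreover have "{b - 1<..c} = insert b {b<..c}" if "b \<le> c" for c using that by auto
  ultimately show ?thesis
    by (cases "a < b"; cases "a = b") (auto simp: oriented_sum_def)
qed

lemma oriented_sum_telescope:
  "oriented_sum a b (\<lambda>m. g m - g (m - 1)) = g b - g a"
proof (induction b rule: int_induct[of _ a])
  case base
  show ?case by (simp add: oriented_sum_def)
next
  case (step1 b)
  then show ?case
    using oriented_sum_step[of a "b + 1" "\<lambda>m. g m - g (m - 1)"] by (simp add: diff_eq_eq)
next
  case (step2 b)
  have "oriented_sum a (b - 1) (\<lambda>m. g m - g (m - 1)) = oriented_sum a b (\<lambda>m. g m - g (m - 1)) - (g b - g (b - 1))"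
    unfolding oriented_sum_step[of a b "\<lambda>m. g m - g (m - 1)", symmetric] by simp
  with step2 show ?case by simp
qed

lemma corner_diff_diff:
  assumes "k \<le> l"
  shows "corner_diff k a (\<lambda>t. Y t - Y (t(l := t l - 1))) t =
    corner_diff k a Y t - corner_diff k a Y (t(l := t l - 1))"
  using assms
proof (induction k arbitrary: t)
  case (Suc k)
  then have "t(l := t l - 1, k := a k) = t(k := a k, l := t l - 1)"
    by (intro fun_upd_twist) auto
  moreover have "(t(k := a k)) l = t l" using Suc.prems by simp
  ultimately show ?case using Suc by (simp del: fun_upd_apply)
qed simp

text \<open>The discrete fundamental theorem over a box: by induction the inner sum is a corner
  difference, and as a function of the last coordinate it is a backward difference, which
  telescopes.\<close>

lemma box_sum_Delta:
  "box_sum N a (\<lambda>j. Delta N Z j \<omega>) t = corner_diff N a (\<lambda>j. Z j \<omega>) t"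
proof (induction N arbitrary: Z t)
  case 0
  show ?case by (simp add: Delta_def cube_0)
next
  case (Suc N)
  let ?g = "\<lambda>m. corner_diff N a (\<lambda>j. Z j \<omega>) (t(N := m))"
  have "box_sum N a (\<lambda>j. Delta (Suc N) Z j \<omega>) (t(N := m)) = ?g m - ?g (m - 1)" for m
    using corner_diff_diff[OF order_refl, of N a "\<lambda>j. Z j \<omega>" "t(N := m)"]
    by (simp add: Delta_Suc' Suc.IH del: fun_upd_apply add: fun_upd_same)
  then show ?case by (simp add: oriented_sum_telescope[where g = ?g])
qed

text \<open>The other half of the fundamental theorem: differencing in the last direction undoes the
  outermost oriented sum. The base corner a disappears, so it does not matter where the summation
  starts.\<close>

lemma Delta_box_sum:
  "Delta N (\<lambda>t \<omega>. box_sum N a (\<lambda>j. f j \<omega>) t) t \<omega> = f t \<omega>"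
proof (induction N arbitrary: t)
  case 0
  show ?case by (simp add: Delta_def cube_0)
next
  case (Suc N)
  have "box_sum (Suc N) a (\<lambda>j. f j \<omega>) t - box_sum (Suc N) a (\<lambda>j. f j \<omega>) (t(N := t N - 1))
      = box_sum N a (\<lambda>j. f j \<omega>) t" for t \<omega>
    using oriented_sum_step[of "a N" "t N" "\<lambda>m. box_sum N a (\<lambda>j. f j \<omega>) (t(N := m))"] by simp
  then show ?case unfolding Delta_Suc' by (simp only: Suc)
qed

text \<open>The half-open box between a and t, whichever lies lower. Coordinates from N on are
  copied from t, so that the slices in \<open>obox_Suc\<close> are again boxes of this kind.\<close>

definition obox :: "nat \<Rightarrow> (nat \<Rightarrow> int) \<Rightarrow> (nat \<Rightarrow> int) \<Rightarrow> (nat \<Rightarrow> int) set" where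
  "obox N a t = {j. (\<forall>l<N. min (a l) (t l) < j l \<and> j l \<le> max (a l) (t l)) \<and> (\<forall>l\<ge>N. j l = t l)}"

lemma obox_0: "obox 0 a t = {t}"
  by (auto simp: obox_def)

lemma obox_Suc: "obox (Suc N) a t = (\<Union>m\<in>{min (a N) (t N)<..max (a N) (t N)}. obox N a (t(N := m)))"
proof (intro set_eqI iffI)
  fix j assume "j \<in> obox (Suc N) a t"
  then have "j \<in> obox N a (t(N := j N))" "j N \<in> {min (a N) (t N)<..max (a N) (t N)}"
    by (auto simp: obox_def)
  then show "j \<in> (\<Union>m\<in>{min (a N) (t N)<..max (a N) (t N)}. obox N a (t(N := m)))" by blast
next
  fix j assume "j \<in> (\<Union>m\<in>{min (a N) (t N)<..max (a N) (t N)}. obox N a (t(N := m)))"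
  then show "j \<in> obox (Suc N) a t" by (auto simp: obox_def less_Suc_eq Suc_le_eq)
qed

lemma finite_obox: "finite (obox N a t)"
  by (induction N arbitrary: t) (auto simp: obox_0 obox_Suc)

text \<open>Each coordinate with \<open>t l < a l\<close> reverses one oriented sum and contributes
  a factor -1. For a = 0 this is the sign in \<open>Mmap\<close>; for a below t it is 1.\<close>

lemma box_sum_eq_sum:
  fixes f :: "(nat \<Rightarrow> int) \<Rightarrow> 'b::real_vector"
  shows "box_sum N a f t = ((-1) ^ card {l. l < N \<and> t l < a l}) *\<^sub>R (\<Sum>j\<in>obox N a t. f j)"
proof (induction N arbitrary: t)
  case 0
  show ?case by (simp add: obox_0)
next
  case (Suc N)
  define s :: real where "s = (-1) ^ card {l. l < N \<and> t l < a l}"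
  have IH: "box_sum N a f (t(N := m)) = s *\<^sub>R (\<Sum>j\<in>obox N a (t(N := m)). f j)" for m
  proof -
    have "{l. l < N \<and> (t(N := m)) l < a l} = {l. l < N \<and> t l < a l}" by auto
    then show ?thesis by (simp only: Suc s_def)
  qed
  have total: "(\<Sum>j\<in>obox (Suc N) a t. f j) =
      (\<Sum>m\<in>{min (a N) (t N)<..max (a N) (t N)}. \<Sum>j\<in>obox N a (t(N := m)). f j)"
    unfolding obox_Suc
    by (rule sum.UNION_disjoint) (auto simp: finite_obox, auto simp: obox_def)
  have split: "{l. l < Suc N \<and> t l < a l} = {l. l < N \<and> t l < a l} \<union> (if t N < a N then {N} else {})"
    by (auto simp: less_Suc_eq)
  have sign: "(-1) ^ card {l. l < Suc N \<and> t l < a l} = (if t N < a N then - s else s)"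
    unfolding split s_def by auto
  show ?case
    unfolding sign total by (auto simp: oriented_sum_def IH scaleR_sum_right sum_negf)
qed

text \<open>The corner is lowered by 1 because the oriented box excludes its lower end. The minimum
  with \<open>t l\<close> makes the box empty when -M_l lies above t_l; without it the oriented box
  could be turned round and nonempty.\<close>

lemma lowbox_eq_obox:
  assumes "t \<in> ZN N"
  shows "lowbox N Ms t = obox N (\<lambda>l. min (- Ms l - 1) (t l)) t"
proof -
  have "(- M \<le> x \<and> x \<le> T) \<longleftrightarrow> (min (min (- M - 1) T) T < x \<and> x \<le> max (min (- M - 1) T) T)" for M x T :: int
    by (auto simp: min_def max_def)
  moreover have "j \<in> ZN N \<longleftrightarrow> (\<forall>l\<ge>N. j l = t l)" for j
    using assms by (simp add: ZN_def)
  ultimately show ?thesis unfolding lowbox_def obox_def by auto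
qed

lemma mbox_eq_obox:
  assumes "t \<in> ZN N"
  shows "mbox N t = obox N (\<lambda>_. 0) t"
proof -
  have "((0 \<le> T \<longrightarrow> 1 \<le> x \<and> x \<le> T) \<and> (T < 0 \<longrightarrow> T + 1 \<le> x \<and> x \<le> 0)) \<longleftrightarrow> (min 0 T < x \<and> x \<le> max 0 T)"
    for x T :: int
    by (auto simp: min_def max_def)
  moreover have "j \<in> ZN N \<longleftrightarrow> (\<forall>l\<ge>N. j l = t l)" for j
    using assms by (simp add: ZN_def)
  ultimately show ?thesis unfolding mbox_def obox_def by auto
qed

lemma obox_subset_ZN: "t \<in> ZN N \<Longrightarrow> obox N a t \<subseteq> ZN N"
  by (auto simp: obox_def ZN_def)

lemma corner_diff_cong:
  assumes "\<And>l. l < k \<Longrightarrow> a l = b l"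
  shows "corner_diff k a Y t = corner_diff k b Y t"
  using assms by (induction k arbitrary: t) auto

lemma ZN_update: "t \<in> ZN N \<Longrightarrow> l < N \<Longrightarrow> t(l := m) \<in> ZN N"
  by (auto simp: ZN_def)

section \<open>Exponentials of commuting matrices\<close>

locale commuting_matrices =
  fixes N :: nat and \<Theta> :: "nat \<Rightarrow> real^'n^'n"
  assumes commute: "j < N \<Longrightarrow> k < N \<Longrightarrow> \<Theta> j ** \<Theta> k = \<Theta> k ** \<Theta> j"
begin

definition E :: "(nat \<Rightarrow> int) \<Rightarrow> real^'n^'n" where
  "E t = mexp (tstar N \<Theta> t)"

lemma tstar_commute: "tstar N \<Theta> s ** tstar N \<Theta> t = tstar N \<Theta> t ** tstar N \<Theta> s"
proof -
  have *: "(\<Theta> j) ** tstar N \<Theta> t = tstar N \<Theta> t ** \<Theta> j" if "j < N" for j t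
    unfolding tstar_def
    using that by (simp add: matrix_mult_sum sum_matrix_mult scaleR_matrix_mult_left
      scaleR_matrix_mult_right commute)
  show ?thesis
    unfolding tstar_def[of N \<Theta> s]
    by (simp add: matrix_mult_sum sum_matrix_mult scaleR_matrix_mult_left scaleR_matrix_mult_right *)
qed

lemma E_add: "E (\<lambda>k. s k + t k) = E s ** E t"
proof -
  have "tstar N \<Theta> (\<lambda>k. s k + t k) = tstar N \<Theta> s + tstar N \<Theta> t"
    by (simp add: tstar_def scaleR_add_left sum.distrib)
  then show ?thesis unfolding E_def by (simp add: mexp_add_commuting tstar_commute)
qed

lemma E_0: "E (\<lambda>_. 0) = mat 1"
  by (simp add: E_def tstar_def mexp_0)

lemma mexp_minus_tstar: "mexp (- tstar N \<Theta> t) = E (\<lambda>k. - t k)"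
  by (simp add: E_def tstar_def sum_negf)

lemma E_mult_vec: "E s *v (E t *v x) = E (\<lambda>k. s k + t k) *v x"
  by (simp add: E_add matrix_vector_mul_assoc)

lemma E_minus_E: "E (\<lambda>k. - t k) *v (E t *v x) = x" "E t *v (E (\<lambda>k. - t k) *v x) = x"
  by (simp_all add: E_mult_vec E_0)

lemma mexp_coordinate:
  assumes "j < N"
  shows "mexp (of_int m *\<^sub>R \<Theta> j) = E (\<lambda>k. if k = j then m else 0)"
proof -
  have "tstar N \<Theta> (\<lambda>k. if k = j then m else 0) = (\<Sum>k<N. if k = j then of_int m *\<^sub>R \<Theta> j else 0)"
    unfolding tstar_def by (intro sum.cong) auto
  also have "\<dots> = of_int m *\<^sub>R \<Theta> j" using assms by simp
  finally show ?thesis by (simp add: E_def)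
qed

lemma E_update:
  assumes "j < N"
  shows "E (t(j := m)) *v x = E (t(j := 0)) *v (mexp (of_int m *\<^sub>R \<Theta> j) *v x)"
proof -
  have "t(j := m) = (\<lambda>k. (t(j := 0)) k + (if k = j then m else 0))" by auto
  then show ?thesis by (metis E_mult_vec mexp_coordinate[OF assms])
qed

lemma Lmap_eq: "Lmap N \<Theta> X t \<omega> = E t *v X t \<omega>"
  by (simp add: Lmap_def E_def)

text \<open>The residual of the autoregression in (ii): X_t is the term i = 0, and bringing the
  other terms to the left absorbs their extra sign.\<close>

definition innovation :: "((nat \<Rightarrow> int) \<Rightarrow> 'a \<Rightarrow> real^'n) \<Rightarrow> (nat \<Rightarrow> int) \<Rightarrow> 'a \<Rightarrow> real^'n" where
  "innovation X t \<omega> = (\<Sum>i\<in>cube N. ((-1::real) ^ nat (\<Sum>k<N. i k)) *\<^sub>R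
     (E (\<lambda>k. - i k) *v X (\<lambda>k. t k - i k) \<omega>))"

lemma Delta_Lmap: "Delta N (Lmap N \<Theta> X) t \<omega> = E t *v innovation X t \<omega>"
proof -
  have "E t *v (E (\<lambda>k. - i k) *v x) = E (\<lambda>k. t k - i k) *v x" for i x
    by (simp add: E_mult_vec)
  then show ?thesis
    by (simp add: innovation_def Delta_def Lmap_eq matrix_vector_mult_scaleR
      linear_sum[OF matrix_vector_mul_linear])
qed

lemma cond_ii_iff:
  "cond_ii M N \<Theta> X G \<longleftrightarrow> (\<forall>t\<in>ZN N. AE \<omega> in M. innovation X t \<omega> = Delta N G t \<omega>)"
proof -
  have "X t \<omega> = (\<Sum>i\<in>cube N - {\<lambda>_. 0}. ((-1::real) ^ nat (1 + (\<Sum>k<N. i k))) *\<^sub>R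
            (mexp (- tstar N \<Theta> i) *v X (\<lambda>k. t k - i k) \<omega>)) + Delta N G t \<omega>
      \<longleftrightarrow> innovation X t \<omega> = Delta N G t \<omega>" for t \<omega>
  proof -
    let ?h = "\<lambda>i. ((-1::real) ^ nat (\<Sum>k<N. i k)) *\<^sub>R (E (\<lambda>k. - i k) *v X (\<lambda>k. t k - i k) \<omega>)"
    have "innovation X t \<omega> = ?h (\<lambda>_. 0) + sum ?h (cube N - {\<lambda>_. 0})"
      unfolding innovation_def by (rule sum.remove[OF finite_cube zero_in_cube])
    also have "?h (\<lambda>_. 0) = X t \<omega>" by (simp add: E_0)
    finally have "innovation X t \<omega> = X t \<omega> + sum ?h (cube N - {\<lambda>_. 0})" .
    moreover have "(\<Sum>i\<in>cube N - {\<lambda>_. 0}. ((-1::real) ^ nat (1 + (\<Sum>k<N. i k))) *\<^sub>R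
            (mexp (- tstar N \<Theta> i) *v X (\<lambda>k. t k - i k) \<omega>)) = - sum ?h (cube N - {\<lambda>_. 0})"
      unfolding sum_negf[symmetric]
    proof (rule sum.cong[OF refl])
      fix i assume "i \<in> cube N - {\<lambda>_. 0}"
      then have "nat (1 + (\<Sum>k<N. i k)) = Suc (nat (\<Sum>k<N. i k))"
        using cube_sum_nonneg[of i N] by (simp add: nat_add_distrib)
      then show "((-1::real) ^ nat (1 + (\<Sum>k<N. i k))) *\<^sub>R
            (mexp (- tstar N \<Theta> i) *v X (\<lambda>k. t k - i k) \<omega>) = - ?h i"
        by (simp add: mexp_minus_tstar)
    qed
    ultimately show ?thesis by (simp add: algebra_simps)
  qed
  then show ?thesis unfolding cond_ii_def by simp
qed

lemma Mmap_eq_box_sum: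
  assumes "t \<in> ZN N"
  shows "Mmap N \<Theta> Y t \<omega> = box_sum N (\<lambda>_. 0) (\<lambda>j. E (\<lambda>k. - j k) *v Delta N Y j \<omega>) t"
  by (simp add: Mmap_def box_sum_eq_sum mbox_eq_obox[OF assms] mexp_minus_tstar)

text \<open>The factor e^(-j*\<Theta>) in \<open>Mmap\<close> cancels the e^(j*\<Theta>) produced by
  \<open>Lmap\<close>. What remains is the box sum from 0 of the innovations, which
  \<open>Delta\<close> inverts for every sample point.\<close>

lemma Delta_Mmap_Lmap:
  assumes "t \<in> ZN N"
  shows "Delta N (Mmap N \<Theta> (Lmap N \<Theta> X)) t \<omega> = innovation X t \<omega>"
proof -
  have "Delta N (Mmap N \<Theta> (Lmap N \<Theta> X)) t \<omega> =
      Delta N (\<lambda>t \<omega>. box_sum N (\<lambda>_. 0) (\<lambda>j. innovation X j \<omega>) t) t \<omega>"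
    by (intro Delta_cong assms) (simp add: Mmap_eq_box_sum Delta_Lmap E_minus_E)
  then show ?thesis by (simp add: Delta_box_sum)
qed

text \<open>The expansion is iterated backwards: e^\<Theta>_j carries e^(-(m+1)\<Theta>_j) x to
  e^(-m\<Theta>_j) x, so each step gains a factor 1 + c.\<close>

lemma E_negative_decay:
  assumes "j < N" "transpose (\<Theta> j) = \<Theta> j" "pos_def (\<Theta> j)"
  obtains c :: real where "c > 0"
    "\<And>m x. (1 + c) ^ m * norm (mexp (of_int (- int m) *\<^sub>R \<Theta> j) *v x) \<le> norm x"
proof -
  obtain c where c: "c > 0" "\<And>x. (1 + c) * norm x \<le> norm (mexp (\<Theta> j) *v x)"
    using mexp_expansive[OF assms(2,3)] by blast
  have "(1 + c) ^ m * norm (mexp (of_int (- int m) *\<^sub>R \<Theta> j) *v x) \<le> norm x" for m x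
  proof (induction m arbitrary: x)
    case 0
    show ?case by (simp add: mexp_0)
  next
    case (Suc m)
    let ?y = "mexp (of_int (- int (Suc m)) *\<^sub>R \<Theta> j) *v x"
    have "mexp (\<Theta> j) *v ?y = mexp (of_int 1 *\<^sub>R \<Theta> j) *v ?y" by simp
    also have "\<dots> = mexp (of_int (- int m) *\<^sub>R \<Theta> j) *v x"
      unfolding mexp_coordinate[OF assms(1)] E_mult_vec
      by (rule arg_cong[of _ _ "\<lambda>s. E s *v x"]) auto
    finally have "(1 + c) * norm ?y \<le> norm (mexp (of_int (- int m) *\<^sub>R \<Theta> j) *v x)"
      using c(2) by metis
    then have "(1 + c) ^ m * ((1 + c) * norm ?y) \<le> (1 + c) ^ m * norm (mexp (of_int (- int m) *\<^sub>R \<Theta> j) *v x)"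
      using c(1) by (intro mult_left_mono) auto
    also have "\<dots> \<le> norm x" by (rule Suc)
    finally show ?case by (simp add: mult_ac)
  qed
  then show ?thesis using that c(1) by blast
qed

end

section \<open>Limits in probability\<close>

lemma borel_measurable_matrix_vector_mult [measurable (raw)]:
  fixes A :: "real^'n^'n"
  assumes "f \<in> borel_measurable M"
  shows "(\<lambda>x. A *v f x) \<in> borel_measurable M"
  by (rule borel_measurable_continuous_on[OF _ assms]) (intro linear_continuous_on, simp)

text \<open>The added 1 keeps the bound strictly positive for the zero matrix too, so that
  tolerances may be divided by it.\<close>

lemma onorm_bound_pos:
  fixes A :: "real^'n^'n"
  shows "0 < onorm ((*v) A) + 1" "norm (A *v x) \<le> (onorm ((*v) A) + 1) * norm x"
proof -
  show "0 < onorm ((*v) A) + 1"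
    using onorm_pos_le[OF matrix_vector_mul_bounded_linear, of A] by simp
  have "norm (A *v x) \<le> onorm ((*v) A) * norm x" by (rule onorm) simp
  then show "norm (A *v x) \<le> (onorm ((*v) A) + 1) * norm x"
    by (simp add: algebra_simps add_increasing)
qed

context prob_space
begin

lemma conv_in_probD:
  assumes "conv_in_prob M Y L F"
  shows "Y m \<in> borel_measurable M" "L \<in> borel_measurable M"
    "0 < e \<Longrightarrow> ((\<lambda>m. prob {\<omega>\<in>space M. dist (Y m \<omega>) (L \<omega>) > e}) \<longlongrightarrow> 0) F"
  using assms unfolding conv_in_prob_def by blast+

lemma prob_norm_diff_le:
  fixes Y Z :: "'a \<Rightarrow> real^'n"
  assumes [measurable]: "Y \<in> borel_measurable M" "Z \<in> borel_measurable M"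
  shows "prob {\<omega>\<in>space M. norm (Y \<omega> - Z \<omega>) > e} \<le>
    prob {\<omega>\<in>space M. norm (Y \<omega>) > e / 2} + prob {\<omega>\<in>space M. norm (Z \<omega>) > e / 2}" (is "_ \<le> prob ?U + prob ?V")
proof -
  have "{\<omega>\<in>space M. norm (Y \<omega> - Z \<omega>) > e} \<subseteq> ?U \<union> ?V"
  proof safe
    fix \<omega> assume "norm (Y \<omega> - Z \<omega>) > e" "\<not> norm (Z \<omega>) > e / 2"
    then show "norm (Y \<omega>) > e / 2"
      using norm_triangle_ineq4[of "Y \<omega>" "Z \<omega>"] by linarith
  qed
  then have "prob {\<omega>\<in>space M. norm (Y \<omega> - Z \<omega>) > e} \<le> prob (?U \<union> ?V)"
    by (rule finite_measure_mono) measurable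
  also have "\<dots> \<le> prob ?U + prob ?V" by (rule measure_Un_le) measurable
  finally show ?thesis .
qed

lemma conv_in_prob_diff_zero:
  fixes Y Z :: "'i \<Rightarrow> 'a \<Rightarrow> real^'n"
  assumes Y: "conv_in_prob M Y (\<lambda>_. 0) F" and Z: "conv_in_prob M Z (\<lambda>_. 0) F"
  shows "conv_in_prob M (\<lambda>m \<omega>. Y m \<omega> - Z m \<omega>) (\<lambda>_. 0) F"
proof -
  have [measurable]: "Y m \<in> borel_measurable M" "Z m \<in> borel_measurable M" for m
    using Y Z by (auto simp: conv_in_prob_def)
  have "((\<lambda>m. prob {\<omega>\<in>space M. dist (Y m \<omega> - Z m \<omega>) 0 > e}) \<longlongrightarrow> 0) F" if "e > 0" for e
  proof (rule tendsto_sandwich[OF _ _ tendsto_const])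
    have "((\<lambda>m. prob {\<omega>\<in>space M. dist (Y m \<omega>) 0 > e / 2} + prob {\<omega>\<in>space M. dist (Z m \<omega>) 0 > e / 2}) \<longlongrightarrow> 0 + 0) F"
      using that by (intro tendsto_add conv_in_probD(3)[OF Y] conv_in_probD(3)[OF Z]) auto
    then show "((\<lambda>m. prob {\<omega>\<in>space M. dist (Y m \<omega>) 0 > e / 2} + prob {\<omega>\<in>space M. dist (Z m \<omega>) 0 > e / 2}) \<longlongrightarrow> 0) F"
      by simp
    show "\<forall>\<^sub>F m in F. prob {\<omega>\<in>space M. dist (Y m \<omega> - Z m \<omega>) 0 > e}
      \<le> prob {\<omega>\<in>space M. dist (Y m \<omega>) 0 > e / 2} + prob {\<omega>\<in>space M. dist (Z m \<omega>) 0 > e / 2}"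
      using prob_norm_diff_le[of "Y _" "Z _" e] by simp
  qed simp
  then show ?thesis by (simp add: conv_in_prob_def)
qed

lemma prob_matrix_mult_le:
  fixes A :: "real^'n^'n"
  assumes [measurable]: "Y \<in> borel_measurable M"
  shows "prob {\<omega>\<in>space M. norm (A *v Y \<omega>) > e} \<le> prob {\<omega>\<in>space M. norm (Y \<omega>) > e / (onorm ((*v) A) + 1)}"
proof (rule finite_measure_mono)
  let ?K = "onorm ((*v) A) + 1"
  show "{\<omega>\<in>space M. norm (A *v Y \<omega>) > e} \<subseteq> {\<omega>\<in>space M. norm (Y \<omega>) > e / ?K}"
  proof safe
    fix \<omega> assume "e < norm (A *v Y \<omega>)"
    also have "\<dots> \<le> ?K * norm (Y \<omega>)" by (rule onorm_bound_pos)
    finally show "e / ?K < norm (Y \<omega>)"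
      using onorm_bound_pos(1)[of A] by (simp add: pos_divide_less_eq mult.commute)
  qed
qed measurable

lemma conv_in_prob_matrix_mult_zero:
  fixes A :: "real^'n^'n"
  assumes Y: "conv_in_prob M Y (\<lambda>_. 0) F"
  shows "conv_in_prob M (\<lambda>m \<omega>. A *v Y m \<omega>) (\<lambda>_. 0) F"
proof -
  have [measurable]: "Y m \<in> borel_measurable M" for m
    using Y by (auto simp: conv_in_prob_def)
  let ?K = "onorm ((*v) A) + 1"
  have "((\<lambda>m. prob {\<omega>\<in>space M. dist (A *v Y m \<omega>) 0 > e}) \<longlongrightarrow> 0) F" if "e > 0" for e
  proof (rule tendsto_sandwich[OF _ _ tendsto_const])
    show "((\<lambda>m. prob {\<omega>\<in>space M. dist (Y m \<omega>) 0 > e / ?K}) \<longlongrightarrow> 0) F"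
      using Y that onorm_bound_pos(1)[of A] by (auto simp: conv_in_prob_def)
    show "\<forall>\<^sub>F m in F. prob {\<omega>\<in>space M. dist (A *v Y m \<omega>) 0 > e} \<le> prob {\<omega>\<in>space M. dist (Y m \<omega>) 0 > e / ?K}"
      using prob_matrix_mult_le[of "Y _" e A] by simp
  qed simp
  then show ?thesis by (simp add: conv_in_prob_def)
qed

lemma conv_in_prob_compose:
  assumes "conv_in_prob M Y L F" "filterlim g F F'"
  shows "conv_in_prob M (\<lambda>m. Y (g m)) L F'"
  using assms unfolding conv_in_prob_def by (auto intro: filterlim_compose)

section \<open>Corner differences as the lower corner recedes\<close>

definition vanishes_at_bot :: "nat \<Rightarrow> ((nat \<Rightarrow> int) \<Rightarrow> 'a \<Rightarrow> real^'n) \<Rightarrow> bool" where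
  "vanishes_at_bot N Y \<longleftrightarrow>
     (\<forall>l<N. \<forall>t\<in>ZN N. conv_in_prob M (\<lambda>m. Y (t(l := m))) (\<lambda>_. 0) at_bot)"

text \<open>The first k corner choices do not touch coordinate l, so each of the 2^k corners has
  l-th coordinate m, and the alternating sum is a finite combination of vanishing fields.\<close>

lemma corner_diff_vanishes:
  assumes Y: "vanishes_at_bot N Y" and "k \<le> l" "l < N" "t \<in> ZN N"
  shows "conv_in_prob M (\<lambda>m \<omega>. corner_diff k a (\<lambda>j. Y j \<omega>) (t(l := m))) (\<lambda>_. 0) at_bot"
  using assms(2-)
proof (induction k arbitrary: t)
  case 0
  then show ?case using Y by (simp add: vanishes_at_bot_def del: fun_upd_apply)
next
  case (Suc k)
  have "t(l := m, k := a k) = t(k := a k, l := m)" for m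
    using Suc.prems by (intro fun_upd_twist) auto
  then show ?case
    using Suc.prems
    by (auto intro!: conv_in_prob_diff_zero Suc.IH ZN_update simp del: fun_upd_apply)
qed

lemma corner_diff_measurable:
  assumes "\<And>t. t \<in> ZN N \<Longrightarrow> Y t \<in> borel_measurable M" "k \<le> N" "t \<in> ZN N"
  shows "(\<lambda>\<omega>. corner_diff k a (\<lambda>j. Y j \<omega> :: real^'n) t) \<in> borel_measurable M"
  using assms(2-)
proof (induction k arbitrary: t)
  case (Suc k)
  then show ?case
    using ZN_update[of t N k "a k"] by (auto intro!: borel_measurable_diff simp del: fun_upd_apply)
qed (simp add: assms(1))

text \<open>The statement is prepared for induction on the number n of limits still to be taken: the
  lower corner is fixed as a in the first k coordinates and given by cut-offs in the next n. Since
  \<open>ilim\<close> renumbers the cut-offs whenever it fixes the outermost one, coordinate l reads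
  the cut-off numbered l - k. The maps c allow for corners that are not the cut-offs
  themselves.\<close>

lemma corner_diff_ilim:
  fixes Y :: "(nat \<Rightarrow> int) \<Rightarrow> 'a \<Rightarrow> real^'n"
  assumes meas: "\<And>t. t \<in> ZN N \<Longrightarrow> Y t \<in> borel_measurable M"
    and Y: "vanishes_at_bot N Y" and t: "t \<in> ZN N" and "k + n \<le> N"
    and c: "\<And>l. filterlim (c l) at_bot at_top"
  shows "ilim M n (\<lambda>Ms \<omega>. corner_diff (k + n) (\<lambda>l. if l < k then a l else c l (Ms (l - k))) (\<lambda>j. Y j \<omega>) t)
           (\<lambda>\<omega>. corner_diff k a (\<lambda>j. Y j \<omega>) t)"
  using \<open>k + n \<le> N\<close>
proof (induction n arbitrary: k a)
  case 0
  have "corner_diff k (\<lambda>l. if l < k then a l else c l 0) (\<lambda>j. Y j \<omega>) t = corner_diff k a (\<lambda>j. Y j \<omega>) t" for \<omega>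
    by (rule corner_diff_cong) auto
  then show ?case by simp
next
  case (Suc n)
  \<comment> \<open>The inner iterated limit once the outermost cut-off is m: the induction
    hypothesis applies with k + 1 fixed coordinates. Its distance to the claimed limit is one corner
    difference whose coordinate k tends to minus infinity.\<close>
  define L where "L m \<omega> = corner_diff (Suc k) (a(k := c k m)) (\<lambda>j. Y j \<omega>) t" for m \<omega>
  have L: "L m \<omega> = corner_diff k a (\<lambda>j. Y j \<omega>) t - corner_diff k a (\<lambda>j. Y j \<omega>) (t(k := c k m))" for m \<omega>
    using corner_diff_cong[of k "a(k := c k m)" a "\<lambda>j. Y j \<omega>"] by (simp add: L_def)
  have "conv_in_prob M L (\<lambda>\<omega>. corner_diff k a (\<lambda>j. Y j \<omega>) t) at_top"
  proof -
    have "conv_in_prob M (\<lambda>m \<omega>. corner_diff k a (\<lambda>j. Y j \<omega>) (t(k := m))) (\<lambda>_. 0) at_bot"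
      using Suc.prems t by (intro corner_diff_vanishes[OF Y]) auto
    from conv_in_prob_compose[OF this c[of k]]
    have "((\<lambda>m. prob {\<omega>\<in>space M. dist (L m \<omega>) (corner_diff k a (\<lambda>j. Y j \<omega>) t) > e}) \<longlongrightarrow> 0) at_top"
      if "e > 0" for e
      using that by (simp add: conv_in_prob_def L dist_norm)
    moreover have "L m \<in> borel_measurable M" for m
      unfolding L_def using Suc.prems by (intro corner_diff_measurable[OF meas _ t]) auto
    moreover have "(\<lambda>\<omega>. corner_diff k a (\<lambda>j. Y j \<omega>) t) \<in> borel_measurable M"
      using Suc.prems by (intro corner_diff_measurable[OF meas _ t]) auto
    ultimately show ?thesis by (simp add: conv_in_prob_def)
  qed
  moreover have "ilim M n (\<lambda>Ms \<omega>. corner_diff (k + Suc n)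
      (\<lambda>l. if l < k then a l else c l ((\<lambda>l. if l = 0 then m else Ms (l - 1)) (l - k))) (\<lambda>j. Y j \<omega>) t) (L m)" for m
  proof -
    have "(\<lambda>l. if l < k then a l else c l ((\<lambda>l. if l = 0 then m else Ms (l - 1)) (l - k))) =
      (\<lambda>l. if l < Suc k then (a(k := c k m)) l else c l (Ms (l - Suc k)))" for Ms
      by (auto simp: fun_eq_iff)
    moreover have "ilim M n (\<lambda>Ms \<omega>. corner_diff (Suc k + n)
        (\<lambda>l. if l < Suc k then (a(k := c k m)) l else c l (Ms (l - Suc k))) (\<lambda>j. Y j \<omega>) t) (L m)"
      unfolding L_def using Suc.prems by (intro Suc.IH) simp
    ultimately show ?thesis by (simp only: add_Suc_shift)
  qed
  ultimately show ?case unfolding ilim.simps by blast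
qed

text \<open>The null set may depend on the cut-offs, since the base case of \<open>ilim\<close>
  compares one fully specified partial sum at a time.\<close>

lemma ilim_AE_cong:
  assumes "ilim M k F L" "\<And>Ms. AE \<omega> in M. F Ms \<omega> = F' Ms \<omega>"
  shows "ilim M k F' L"
  using assms
proof (induction k arbitrary: F F' L)
  case 0
  from 0(1) have "AE \<omega> in M. F (\<lambda>_. 0) \<omega> = L \<omega>" by simp
  then have "AE \<omega> in M. F' (\<lambda>_. 0) \<omega> = L \<omega>" using 0(2)[of "\<lambda>_. 0"] by eventually_elim simp
  then show ?case by simp
next
  case (Suc k)
  then obtain Y where Y: "conv_in_prob M Y L at_top"
      "\<And>m. ilim M k (\<lambda>Ms. F (\<lambda>l. if l = 0 then m else Ms (l - 1))) (Y m)" by auto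
  have "ilim M k (\<lambda>Ms. F' (\<lambda>l. if l = 0 then m else Ms (l - 1))) (Y m)" for m
    by (rule Suc.IH[OF Y(2)]) (rule Suc.prems(2))
  with Y(1) show ?case by auto
qed

text \<open>The lower corner is chosen one coordinate at a time, simultaneously for finitely many fields
  and upper corners.\<close>

lemma corner_diff_approx:
  fixes Ys :: "((nat \<Rightarrow> int) \<Rightarrow> 'a \<Rightarrow> real^'n) set"
  assumes fin: "finite Ys" "finite T" and T: "T \<subseteq> ZN N"
    and meas: "\<And>Y t. Y \<in> Ys \<Longrightarrow> t \<in> ZN N \<Longrightarrow> Y t \<in> borel_measurable M"
    and Ys: "\<And>Y. Y \<in> Ys \<Longrightarrow> vanishes_at_bot N Y"
    and "k \<le> N" "0 < e" "0 < d"
  shows "\<exists>a. (\<forall>l<k. a l \<le> b) \<and> (\<forall>Y\<in>Ys. \<forall>t\<in>T.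
    prob {\<omega>\<in>space M. norm (corner_diff k a (\<lambda>j. Y j \<omega>) t - Y t \<omega>) > e} < d)"
  using assms(6-)
proof (induction k arbitrary: e d)
  case 0
  then show ?case by simp
next
  case (Suc k)
  then obtain a where a: "\<forall>l<k. a l \<le> b" "\<And>Y t. Y \<in> Ys \<Longrightarrow> t \<in> T \<Longrightarrow>
      prob {\<omega>\<in>space M. norm (corner_diff k a (\<lambda>j. Y j \<omega>) t - Y t \<omega>) > e / 2} < d / 2"
    using Suc.IH[of "e / 2" "d / 2"] by auto
  \<comment> \<open>Finitely many pairs (Y, t) allow one common m. The halves of e and d are shared
    between the error already present and the one added by this coordinate.\<close>
  have "\<forall>\<^sub>F m in at_bot. \<forall>Y\<in>Ys. \<forall>t\<in>T.
      prob {\<omega>\<in>space M. norm (corner_diff k a (\<lambda>j. Y j \<omega>) (t(k := m))) > e / 2} < d / 2"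
  proof (intro eventually_ball_finite fin ballI)
    fix Y t assume "Y \<in> Ys" "t \<in> T"
    then have "conv_in_prob M (\<lambda>m \<omega>. corner_diff k a (\<lambda>j. Y j \<omega>) (t(k := m))) (\<lambda>_. 0) at_bot"
      using Suc.prems T by (intro corner_diff_vanishes[OF Ys]) auto
    from conv_in_probD(3)[OF this, of "e / 2"]
    have "((\<lambda>m. prob {\<omega>\<in>space M. norm (corner_diff k a (\<lambda>j. Y j \<omega>) (t(k := m))) > e / 2}) \<longlongrightarrow> 0) at_bot"
      using Suc.prems by (simp del: fun_upd_apply less_divide_eq_numeral1)
    then show "\<forall>\<^sub>F m in at_bot. prob {\<omega>\<in>space M. norm (corner_diff k a (\<lambda>j. Y j \<omega>) (t(k := m))) > e / 2} < d / 2"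
      using Suc.prems by (intro order_tendstoD(2)[of _ 0]) auto
  qed
  moreover have "\<forall>\<^sub>F m in at_bot. m \<le> b" by (rule eventually_le_at_bot)
  ultimately have "\<forall>\<^sub>F m in at_bot. m \<le> b \<and> (\<forall>Y\<in>Ys. \<forall>t\<in>T.
      prob {\<omega>\<in>space M. norm (corner_diff k a (\<lambda>j. Y j \<omega>) (t(k := m))) > e / 2} < d / 2)"
    by eventually_elim blast
  then obtain m where m: "m \<le> b" "\<And>Y t. Y \<in> Ys \<Longrightarrow> t \<in> T \<Longrightarrow>
      prob {\<omega>\<in>space M. norm (corner_diff k a (\<lambda>j. Y j \<omega>) (t(k := m))) > e / 2} < d / 2"
    unfolding eventually_at_bot_linorder by blast
  have "prob {\<omega>\<in>space M. norm (corner_diff (Suc k) (a(k := m)) (\<lambda>j. Y j \<omega>) t - Y t \<omega>) > e} < d"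
    if Y: "Y \<in> Ys" and "t \<in> T" for Y t
  proof -
    have tZ: "t \<in> ZN N" "t(k := m) \<in> ZN N" using that T Suc.prems by (auto intro: ZN_update)
    let ?U = "{\<omega>\<in>space M. norm (corner_diff k a (\<lambda>j. Y j \<omega>) t - Y t \<omega>) > e / 2}"
    let ?V = "{\<omega>\<in>space M. norm (corner_diff k a (\<lambda>j. Y j \<omega>) (t(k := m))) > e / 2}"
    have [measurable]: "(\<lambda>\<omega>. corner_diff k a (\<lambda>j. Y j \<omega>) t) \<in> borel_measurable M"
      "(\<lambda>\<omega>. corner_diff k a (\<lambda>j. Y j \<omega>) (t(k := m))) \<in> borel_measurable M" "Y t \<in> borel_measurable M"
      using Suc.prems tZ by (auto intro!: corner_diff_measurable[OF meas[OF Y]] meas[OF Y])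
    have eq: "corner_diff (Suc k) (a(k := m)) (\<lambda>j. Y j \<omega>) t =
        corner_diff k a (\<lambda>j. Y j \<omega>) t - corner_diff k a (\<lambda>j. Y j \<omega>) (t(k := m))" for \<omega>
      using corner_diff_cong[of k "a(k := m)" a "\<lambda>j. Y j \<omega>"] by simp
    have "corner_diff (Suc k) (a(k := m)) (\<lambda>j. Y j \<omega>) t - Y t \<omega> =
        (corner_diff k a (\<lambda>j. Y j \<omega>) t - Y t \<omega>) - corner_diff k a (\<lambda>j. Y j \<omega>) (t(k := m))" for \<omega>
      unfolding eq by simp
    then have "prob {\<omega>\<in>space M. norm (corner_diff (Suc k) (a(k := m)) (\<lambda>j. Y j \<omega>) t - Y t \<omega>) > e} \<le> prob ?U + prob ?V"
      by (simp only:) (intro prob_norm_diff_le; measurable)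
    also have "\<dots> < d" using a(2)[OF that] m(2)[OF that] by simp
    finally show ?thesis .
  qed
  moreover have "\<forall>l<Suc k. (a(k := m)) l \<le> b" using a(1) m(1) by (auto simp: less_Suc_eq)
  ultimately show ?case by blast
qed

end

section \<open>Equality of finite-dimensional distributions\<close>

text \<open>Closed orthants generate the product sigma-algebra, provided each factor has a countable
  cover by generators; the orthants with corner (n, ..., n) supply it.\<close>

lemma sets_PiM_borel_atMost:
  fixes J :: "'i set"
  assumes "finite J"
  shows "sets (PiM J (\<lambda>_. borel :: (real^'n) measure)) =
    sigma_sets (PiE J (\<lambda>_. UNIV)) (range (\<lambda>a. {f \<in> PiE J (\<lambda>_. UNIV). \<forall>i\<in>J. f i \<le> a i}))"
proof -
  let ?E = "range (\<lambda>a. {..a::real^'n})"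
  have cover: "\<exists>S\<subseteq>?E. countable S \<and> (UNIV::(real^'n) set) = \<Union>S"
  proof (intro exI conjI)
    show "(\<lambda>n::nat. {..(\<chi> i. real n) :: real^'n}) ` UNIV \<subseteq> ?E" by auto
    show "(UNIV::(real^'n) set) = \<Union> (range (\<lambda>n::nat. {..(\<chi> i. real n) :: real^'n}))"
    proof (intro equalityI subsetI)
      fix x :: "real^'n"
      obtain n :: nat where "norm x \<le> real n" using real_arch_simple by blast
      then have "x \<le> (\<chi> i. real n)"
        using component_le_norm_cart[of x] by (auto simp: less_eq_vec_def intro: order_trans abs_le_D1)
      then show "x \<in> \<Union> (range (\<lambda>n::nat. {..(\<chi> i. real n) :: real^'n}))" by blast
    qed simp
  qed simp
  have "sets (PiM J (\<lambda>_. borel :: (real^'n) measure)) = sets (PiM J (\<lambda>_. sigma UNIV ?E))"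
    by (subst borel_eq_atMost) simp
  also have "\<dots> = sets (sigma (PiE J (\<lambda>_. UNIV))
      {{f\<in>(PiE J (\<lambda>_. UNIV)). \<forall>i\<in>j. f i \<in> A i} | A j. j \<in> {J} \<and> A \<in> Pi j (\<lambda>_. ?E)})"
    using assms cover by (intro sets_PiM_sigma) auto
  also have "{{f\<in>(PiE J (\<lambda>_. UNIV)). \<forall>i\<in>j. f i \<in> A i} | A j. j \<in> {J} \<and> A \<in> Pi j (\<lambda>_. ?E)} =
      range (\<lambda>a. {f \<in> PiE J (\<lambda>_. UNIV). \<forall>i\<in>J. f i \<le> a i})" (is "?P = ?Q")
  proof (intro equalityI subsetI)
    fix S assume "S \<in> ?P"
    then obtain A where A: "S = {f\<in>(PiE J (\<lambda>_. UNIV)). \<forall>i\<in>J. f i \<in> A i}" "\<forall>i\<in>J. \<exists>a. A i = {..a}"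
      by (auto simp: Pi_iff image_iff)
    from A(2) obtain a where "\<forall>i\<in>J. A i = {..a i}" by metis
    with A(1) have "S = {f \<in> PiE J (\<lambda>_. UNIV). \<forall>i\<in>J. f i \<le> a i}" by auto
    then show "S \<in> ?Q" by blast
  next
    fix S assume "S \<in> ?Q"
    then obtain a where "S = {f \<in> PiE J (\<lambda>_. UNIV). \<forall>i\<in>J. f i \<in> {..a i}}" by auto
    then show "S \<in> ?P" by (intro CollectI exI[of _ "\<lambda>i. {..a i}"] exI[of _ J]) auto
  qed
  finally show ?thesis by (subst (asm) sets_measure_of) auto
qed

lemma vec_le_shift:
  fixes x y a :: "real^'n"
  assumes "x \<le> a" "norm (y - x) \<le> e"
  shows "y \<le> a + (\<chi> i. e)"
  unfolding less_eq_vec_def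
proof
  fix i
  have "\<bar>(y - x) $ i\<bar> \<le> e" using component_le_norm_cart[of "y - x" i] assms(2) by linarith
  moreover have "x $ i \<le> a $ i" using assms(1) by (simp add: less_eq_vec_def)
  ultimately show "y $ i \<le> (a + (\<chi> i. e)) $ i" by simp
qed

context prob_space
begin

lemma emeasure_distr_orthant:
  fixes Z :: "'i \<Rightarrow> 'a \<Rightarrow> real^'n"
  assumes J: "finite J" and Z: "\<And>t. t \<in> J \<Longrightarrow> Z t \<in> borel_measurable M"
  shows "emeasure (distr M (PiM J (\<lambda>_. borel)) (\<lambda>\<omega>. restrict (\<lambda>t. Z t \<omega>) J))
      {f \<in> PiE J (\<lambda>_. UNIV). \<forall>i\<in>J. f i \<le> a i} = prob {\<omega>\<in>space M. \<forall>t\<in>J. Z t \<omega> \<le> a t}"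
    (is "emeasure _ ?R = _")
proof -
  have "?R \<in> sets (PiM J (\<lambda>_. borel))"
    unfolding sets_PiM_borel_atMost[OF J] by (rule sigma_sets.Basic) blast
  then have "emeasure (distr M (PiM J (\<lambda>_. borel)) (\<lambda>\<omega>. restrict (\<lambda>t. Z t \<omega>) J)) ?R =
      emeasure M ((\<lambda>\<omega>. restrict (\<lambda>t. Z t \<omega>) J) -` ?R \<inter> space M)"
    using Z by (intro emeasure_distr measurable_restrict) auto
  also have "(\<lambda>\<omega>. restrict (\<lambda>t. Z t \<omega>) J) -` ?R \<inter> space M = {\<omega>\<in>space M. \<forall>t\<in>J. Z t \<omega> \<le> a t}"
    by auto
  finally show ?thesis unfolding emeasure_eq_measure .
qed

text \<open>Orthants are stable under intersection, corners being met componentwise, and increase to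
  the whole space, so the uniqueness theorem for measures applies to the joint laws.\<close>

lemma distr_PiM_eqI:
  fixes X1 X2 :: "'i \<Rightarrow> 'a \<Rightarrow> real^'n"
  assumes J: "finite J"
    and X1: "\<And>t. t \<in> J \<Longrightarrow> X1 t \<in> borel_measurable M"
    and X2: "\<And>t. t \<in> J \<Longrightarrow> X2 t \<in> borel_measurable M"
    and eq: "\<And>a. prob {\<omega>\<in>space M. \<forall>t\<in>J. X1 t \<omega> \<le> a t} = prob {\<omega>\<in>space M. \<forall>t\<in>J. X2 t \<omega> \<le> a t}"
  shows "distr M (PiM J (\<lambda>_. borel)) (\<lambda>\<omega>. restrict (\<lambda>t. X1 t \<omega>) J) =
    distr M (PiM J (\<lambda>_. borel)) (\<lambda>\<omega>. restrict (\<lambda>t. X2 t \<omega>) J)" (is "?D1 = ?D2")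
proof (rule measure_eqI_generator_eq)
  let ?R = "\<lambda>a. {f \<in> PiE J (\<lambda>_. UNIV). \<forall>i\<in>J. f i \<le> a i} :: ('i \<Rightarrow> real^'n) set"
  note em = emeasure_distr_orthant[OF J]
  show "Int_stable (range ?R)"
  proof (rule Int_stableI_image)
    fix a b :: "'i \<Rightarrow> real^'n"
    have "?R a \<inter> ?R b = ?R (\<lambda>i. inf (a i) (b i))" by auto
    then show "\<exists>c\<in>UNIV. ?R a \<inter> ?R b = ?R c"
      by (intro bexI[of _ "\<lambda>i. inf (a i) (b i)"]) simp_all
  qed
  show "range ?R \<subseteq> Pow (PiE J (\<lambda>_. UNIV))" by auto
  show "emeasure ?D1 S = emeasure ?D2 S" if "S \<in> range ?R" for S
    using that by (auto simp: em X1 X2 eq)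
  show "sets ?D1 = sigma_sets (PiE J (\<lambda>_. UNIV)) (range ?R)" "sets ?D2 = sigma_sets (PiE J (\<lambda>_. UNIV)) (range ?R)"
    by (simp_all add: sets_PiM_borel_atMost[OF J])
  show "range (\<lambda>n::nat. ?R (\<lambda>_. \<chi> i. real n)) \<subseteq> range ?R"
    using rangeI[of ?R] by (intro image_subsetI) simp
  show "(\<Union>n::nat. ?R (\<lambda>_. \<chi> i. real n)) = PiE J (\<lambda>_. UNIV)"
  proof (intro equalityI subsetI)
    fix f :: "'i \<Rightarrow> real^'n" assume f: "f \<in> PiE J (\<lambda>_. UNIV)"
    obtain n :: nat where n: "(\<Sum>t\<in>J. norm (f t)) \<le> real n" using real_arch_simple by blast
    have "f t \<le> (\<chi> i. real n)" if "t \<in> J" for t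
    proof -
      have "norm (f t) \<le> (\<Sum>t\<in>J. norm (f t))" using J that by (intro member_le_sum) auto
      with n have "\<bar>f t $ i\<bar> \<le> real n" for i
        using component_le_norm_cart[of "f t" i] by linarith
      then show ?thesis by (auto simp: less_eq_vec_def intro: abs_le_D1)
    qed
    with f show "f \<in> (\<Union>n::nat. ?R (\<lambda>_. \<chi> i. real n))" by auto
  qed auto
  show "emeasure ?D1 (?R (\<lambda>_. \<chi> i. real n)) \<noteq> \<infinity>" for n :: nat
    by (simp add: em X1)
qed

section \<open>Approximation of orthant probabilities\<close>

lemma orthant_event:
  fixes Z :: "'i \<Rightarrow> 'a \<Rightarrow> real^'n"
  assumes J: "finite J" and Z: "\<And>t. t \<in> J \<Longrightarrow> Z t \<in> borel_measurable M"
  shows "{\<omega>\<in>space M. \<forall>t\<in>J. Z t \<omega> \<le> b t} \<in> events"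
proof (rule sets.sets_Collect_finite_All[OF _ J])
  fix t assume "t \<in> J"
  then have "Z t -` {..b t} \<inter> space M \<in> events"
    by (intro measurable_sets[OF Z] borel_closed closed_eucl_atMost)
  moreover have "Z t -` {..b t} \<inter> space M = {\<omega>\<in>space M. Z t \<omega> \<le> b t}" by auto
  ultimately show "{\<omega>\<in>space M. Z t \<omega> \<le> b t} \<in> events" by simp
qed

text \<open>Off the union of the \<open>card J\<close> exceptional events every component moves by
  at most e, so raising the corner by e in each component keeps the sample point inside the
  orthant.\<close>

lemma prob_orthant_shift:
  fixes X Y :: "'i \<Rightarrow> 'a \<Rightarrow> real^'n"
  assumes J: "finite J"
    and X [measurable]: "\<And>t. t \<in> J \<Longrightarrow> X t \<in> borel_measurable M"
    and Y [measurable]: "\<And>t. t \<in> J \<Longrightarrow> Y t \<in> borel_measurable M"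
    and close: "\<And>t. t \<in> J \<Longrightarrow> prob {\<omega>\<in>space M. norm (Y t \<omega> - X t \<omega>) > e} \<le> e"
  shows "prob {\<omega>\<in>space M. \<forall>t\<in>J. X t \<omega> \<le> a t} \<le>
    prob {\<omega>\<in>space M. \<forall>t\<in>J. Y t \<omega> \<le> a t + (\<chi> i. e)} + real (card J) * e"
proof -
  let ?B = "\<lambda>t. {\<omega>\<in>space M. norm (Y t \<omega> - X t \<omega>) > e}"
  have B: "?B t \<in> events" if "t \<in> J" for t using that by measurable
  have "{\<omega>\<in>space M. \<forall>t\<in>J. X t \<omega> \<le> a t} \<subseteq> {\<omega>\<in>space M. \<forall>t\<in>J. Y t \<omega> \<le> a t + (\<chi> i. e)} \<union> (\<Union>t\<in>J. ?B t)"
    by (auto simp: not_less intro: vec_le_shift)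
  then have "prob {\<omega>\<in>space M. \<forall>t\<in>J. X t \<omega> \<le> a t} \<le> prob ({\<omega>\<in>space M. \<forall>t\<in>J. Y t \<omega> \<le> a t + (\<chi> i. e)} \<union> (\<Union>t\<in>J. ?B t))"
    using J B Y by (intro finite_measure_mono sets.Un sets.finite_UN orthant_event) auto
  also have "\<dots> \<le> prob {\<omega>\<in>space M. \<forall>t\<in>J. Y t \<omega> \<le> a t + (\<chi> i. e)} + prob (\<Union>t\<in>J. ?B t)"
    using J B Y by (intro measure_Un_le sets.finite_UN orthant_event) auto
  also have "prob (\<Union>t\<in>J. ?B t) \<le> (\<Sum>t\<in>J. prob (?B t))"
    using J B by (intro measure_UNION_le) auto
  also have "\<dots> \<le> (\<Sum>t\<in>J. e)" using close by (intro sum_mono) auto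
  finally show ?thesis by simp
qed

text \<open>Continuity from above: closed orthants with corners decreasing to a shrink to the closed
  orthant at a. The factor 2 anticipates that the comparison of two laws shifts the corner
  twice.\<close>

lemma prob_orthant_right_continuous:
  fixes X :: "'i \<Rightarrow> 'a \<Rightarrow> real^'n"
  assumes J: "finite J" and X: "\<And>t. t \<in> J \<Longrightarrow> X t \<in> borel_measurable M"
  shows "(\<lambda>n. prob {\<omega>\<in>space M. \<forall>t\<in>J. X t \<omega> \<le> a t + (\<chi> i. 2 * inverse (real (Suc n)))})
    \<longlonglongrightarrow> prob {\<omega>\<in>space M. \<forall>t\<in>J. X t \<omega> \<le> a t}"
proof -
  let ?A = "\<lambda>n. {\<omega>\<in>space M. \<forall>t\<in>J. X t \<omega> \<le> a t + (\<chi> i. 2 * inverse (real (Suc n)))}"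
  have "range ?A \<subseteq> events" using orthant_event[OF J X] by auto
  moreover have "decseq ?A"
  proof (rule decseq_SucI, safe)
    fix n \<omega> t assume *: "\<forall>t\<in>J. X t \<omega> \<le> a t + (\<chi> i. 2 * inverse (real (Suc (Suc n))))" "t \<in> J"
    have "inverse (real (Suc (Suc n))) \<le> inverse (real (Suc n))" by (intro le_imp_inverse_le) auto
    then have "a t + (\<chi> i. 2 * inverse (real (Suc (Suc n)))) \<le> a t + (\<chi> i. 2 * inverse (real (Suc n)))"
      by (simp add: less_eq_vec_def)
    with * show "X t \<omega> \<le> a t + (\<chi> i. 2 * inverse (real (Suc n)))" by (meson order_trans)
  qed
  ultimately have "(\<lambda>n. prob (?A n)) \<longlonglongrightarrow> prob (\<Inter>n. ?A n)"
    by (rule finite_Lim_measure_decseq)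
  also have "(\<Inter>n. ?A n) = {\<omega>\<in>space M. \<forall>t\<in>J. X t \<omega> \<le> a t}"
  proof (intro equalityI subsetI)
    fix \<omega> assume \<omega>: "\<omega> \<in> (\<Inter>n. ?A n)"
    have "X t \<omega> $ i \<le> a t $ i" if "t \<in> J" for t i
    proof (rule LIMSEQ_le_const)
      show "(\<lambda>n. a t $ i + 2 * inverse (real (Suc n))) \<longlonglongrightarrow> a t $ i"
        using tendsto_add[OF tendsto_const tendsto_mult_right_zero[OF LIMSEQ_inverse_real_of_nat, of 2], of "a t $ i"] by simp
      show "\<exists>n0. \<forall>n\<ge>n0. X t \<omega> $ i \<le> a t $ i + 2 * inverse (real (Suc n))"
        using \<omega> that by (auto simp: less_eq_vec_def)
    qed
    then show "\<omega> \<in> {\<omega>\<in>space M. \<forall>t\<in>J. X t \<omega> \<le> a t}" using \<omega> by (auto simp: less_eq_vec_def)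
  next
    fix \<omega> assume \<omega>: "\<omega> \<in> {\<omega>\<in>space M. \<forall>t\<in>J. X t \<omega> \<le> a t}"
    have "X t \<omega> \<le> a t + (\<chi> i. 2 * inverse (real (Suc n)))" if "t \<in> J" for n t
      using \<omega> that by (auto simp: less_eq_vec_def add_increasing2)
    with \<omega> show "\<omega> \<in> (\<Inter>n. ?A n)" by auto
  qed
  finally show ?thesis .
qed

text \<open>Joint distribution functions determine the law: an approximation with error \<open>e\<close> moves
  the corner of an orthant by \<open>e\<close>, and these distribution functions are right-continuous.\<close>

lemma distr_eqI_approx:
  fixes X1 X2 :: "'i \<Rightarrow> 'a \<Rightarrow> real^'n"
  assumes J: "finite J"
    and X1: "\<And>t. t \<in> J \<Longrightarrow> X1 t \<in> borel_measurable M"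
    and X2: "\<And>t. t \<in> J \<Longrightarrow> X2 t \<in> borel_measurable M"
    and approx: "\<And>e::real. 0 < e \<Longrightarrow> \<exists>S1 S2. (\<forall>t\<in>J. S1 t \<in> borel_measurable M \<and> S2 t \<in> borel_measurable M \<and>
        prob {\<omega>\<in>space M. norm (S1 t \<omega> - X1 t \<omega>) > e} \<le> e \<and> prob {\<omega>\<in>space M. norm (S2 t \<omega> - X2 t \<omega>) > e} \<le> e) \<and>
        distr M (PiM J (\<lambda>_. borel)) (\<lambda>\<omega>. restrict (\<lambda>t. S1 t \<omega>) J) =
        distr M (PiM J (\<lambda>_. borel)) (\<lambda>\<omega>. restrict (\<lambda>t. S2 t \<omega>) J)"
  shows "distr M (PiM J (\<lambda>_. borel)) (\<lambda>\<omega>. restrict (\<lambda>t. X1 t \<omega>) J) =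
    distr M (PiM J (\<lambda>_. borel)) (\<lambda>\<omega>. restrict (\<lambda>t. X2 t \<omega>) J)"
proof (rule distr_PiM_eqI[OF J X1 X2])
  fix a :: "'i \<Rightarrow> real^'n"
  have law: "prob {\<omega>\<in>space M. \<forall>t\<in>J. S1 t \<omega> \<le> b t} = prob {\<omega>\<in>space M. \<forall>t\<in>J. S2 t \<omega> \<le> b t}"
    if S: "\<And>t. t \<in> J \<Longrightarrow> S1 t \<in> borel_measurable M" "\<And>t. t \<in> J \<Longrightarrow> S2 t \<in> borel_measurable M"
      and eq: "distr M (PiM J (\<lambda>_. borel)) (\<lambda>\<omega>. restrict (\<lambda>t. S1 t \<omega>) J) =
        distr M (PiM J (\<lambda>_. borel)) (\<lambda>\<omega>. restrict (\<lambda>t. S2 t \<omega>) J)" for S1 S2 and b :: "'i \<Rightarrow> real^'n"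
  proof -
    have "ennreal (prob {\<omega>\<in>space M. \<forall>t\<in>J. S1 t \<omega> \<le> b t}) = ennreal (prob {\<omega>\<in>space M. \<forall>t\<in>J. S2 t \<omega> \<le> b t})"
      using emeasure_distr_orthant[OF J, of S1 b] emeasure_distr_orthant[OF J, of S2 b] S
      by (simp only: eq)
    then show ?thesis by simp
  qed
  \<comment> \<open>Only an inequality is proved, for arbitrary fields; exchanging the two fields
    and their approximations gives the reverse one.\<close>
  have bound: "prob {\<omega>\<in>space M. \<forall>t\<in>J. Z1 t \<omega> \<le> a t} \<le> prob {\<omega>\<in>space M. \<forall>t\<in>J. Z2 t \<omega> \<le> a t}"
    if Z: "\<And>t. t \<in> J \<Longrightarrow> Z1 t \<in> borel_measurable M" "\<And>t. t \<in> J \<Longrightarrow> Z2 t \<in> borel_measurable M"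
      and approx: "\<And>e::real. 0 < e \<Longrightarrow> \<exists>S1 S2. (\<forall>t\<in>J. S1 t \<in> borel_measurable M \<and> S2 t \<in> borel_measurable M \<and>
        prob {\<omega>\<in>space M. norm (S1 t \<omega> - Z1 t \<omega>) > e} \<le> e \<and> prob {\<omega>\<in>space M. norm (S2 t \<omega> - Z2 t \<omega>) > e} \<le> e) \<and>
        distr M (PiM J (\<lambda>_. borel)) (\<lambda>\<omega>. restrict (\<lambda>t. S1 t \<omega>) J) =
        distr M (PiM J (\<lambda>_. borel)) (\<lambda>\<omega>. restrict (\<lambda>t. S2 t \<omega>) J)" for Z1 Z2 :: "'i \<Rightarrow> 'a \<Rightarrow> real^'n"
  proof (rule LIMSEQ_le_const)
    let ?e = "\<lambda>n. inverse (real (Suc n))"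
    \<comment> \<open>Corner shift and error are doubled: one shift by \<open>?e n\<close> leads
      from Z1 to S1 and a second from S2 to Z2, with equality in law in between.\<close>
    let ?F = "\<lambda>n. prob {\<omega>\<in>space M. \<forall>t\<in>J. Z2 t \<omega> \<le> a t + (\<chi> i. 2 * ?e n)} + 2 * real (card J) * ?e n"
    show "?F \<longlonglongrightarrow> prob {\<omega>\<in>space M. \<forall>t\<in>J. Z2 t \<omega> \<le> a t}"
      using tendsto_add[OF prob_orthant_right_continuous[OF J Z(2), where a=a]
        tendsto_mult_right_zero[OF LIMSEQ_inverse_real_of_nat, of "2 * real (card J)"]] by simp
    have "prob {\<omega>\<in>space M. \<forall>t\<in>J. Z1 t \<omega> \<le> a t} \<le> ?F n" for n
    proof -
      have e: "0 < ?e n" by simp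
      obtain S1 S2 where S: "\<And>t. t \<in> J \<Longrightarrow> S1 t \<in> borel_measurable M" "\<And>t. t \<in> J \<Longrightarrow> S2 t \<in> borel_measurable M"
        "\<And>t. t \<in> J \<Longrightarrow> prob {\<omega>\<in>space M. norm (S1 t \<omega> - Z1 t \<omega>) > ?e n} \<le> ?e n"
        "\<And>t. t \<in> J \<Longrightarrow> prob {\<omega>\<in>space M. norm (S2 t \<omega> - Z2 t \<omega>) > ?e n} \<le> ?e n"
        "distr M (PiM J (\<lambda>_. borel)) (\<lambda>\<omega>. restrict (\<lambda>t. S1 t \<omega>) J) =
         distr M (PiM J (\<lambda>_. borel)) (\<lambda>\<omega>. restrict (\<lambda>t. S2 t \<omega>) J)"
        using approx[OF e] by blast
      have "prob {\<omega>\<in>space M. \<forall>t\<in>J. Z1 t \<omega> \<le> a t} \<le>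
          prob {\<omega>\<in>space M. \<forall>t\<in>J. S1 t \<omega> \<le> a t + (\<chi> i. ?e n)} + real (card J) * ?e n"
        by (rule prob_orthant_shift[OF J Z(1) S(1,3)])
      also have "prob {\<omega>\<in>space M. \<forall>t\<in>J. S1 t \<omega> \<le> a t + (\<chi> i. ?e n)} =
          prob {\<omega>\<in>space M. \<forall>t\<in>J. S2 t \<omega> \<le> a t + (\<chi> i. ?e n)}"
        by (rule law[OF S(1,2,5)])
      also have "\<dots> \<le> prob {\<omega>\<in>space M. \<forall>t\<in>J. Z2 t \<omega> \<le> (a t + (\<chi> i. ?e n)) + (\<chi> i. ?e n)} + real (card J) * ?e n"
        using S(4) by (intro prob_orthant_shift[OF J S(2) Z(2)]) (simp_all add: norm_minus_commute)
      also have "(\<lambda>t. (a t + (\<chi> i. ?e n)) + (\<chi> i. ?e n)) = (\<lambda>t. a t + (\<chi> i. 2 * ?e n))"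
        by (simp add: fun_eq_iff vec_eq_iff)
      finally show ?thesis by (simp add: algebra_simps)
    qed
    then show "\<exists>n0. \<forall>n\<ge>n0. prob {\<omega>\<in>space M. \<forall>t\<in>J. Z1 t \<omega> \<le> a t} \<le> ?F n" by blast
  qed
  show "prob {\<omega>\<in>space M. \<forall>t\<in>J. X1 t \<omega> \<le> a t} = prob {\<omega>\<in>space M. \<forall>t\<in>J. X2 t \<omega> \<le> a t}"
  proof (rule antisym)
    show "prob {\<omega>\<in>space M. \<forall>t\<in>J. X1 t \<omega> \<le> a t} \<le> prob {\<omega>\<in>space M. \<forall>t\<in>J. X2 t \<omega> \<le> a t}"
      by (rule bound[OF X1 X2 approx])
    show "prob {\<omega>\<in>space M. \<forall>t\<in>J. X2 t \<omega> \<le> a t} \<le> prob {\<omega>\<in>space M. \<forall>t\<in>J. X1 t \<omega> \<le> a t}"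
    proof (rule bound[OF X2 X1])
      fix e :: real assume "0 < e"
      then obtain S1 S2 where "\<forall>t\<in>J. S1 t \<in> borel_measurable M \<and> S2 t \<in> borel_measurable M \<and>
        prob {\<omega>\<in>space M. norm (S1 t \<omega> - X1 t \<omega>) > e} \<le> e \<and> prob {\<omega>\<in>space M. norm (S2 t \<omega> - X2 t \<omega>) > e} \<le> e"
        "distr M (PiM J (\<lambda>_. borel)) (\<lambda>\<omega>. restrict (\<lambda>t. S1 t \<omega>) J) =
        distr M (PiM J (\<lambda>_. borel)) (\<lambda>\<omega>. restrict (\<lambda>t. S2 t \<omega>) J)"
        using approx by blast
      then show "\<exists>S1 S2. (\<forall>t\<in>J. S1 t \<in> borel_measurable M \<and> S2 t \<in> borel_measurable M \<and>
        prob {\<omega>\<in>space M. norm (S1 t \<omega> - X2 t \<omega>) > e} \<le> e \<and> prob {\<omega>\<in>space M. norm (S2 t \<omega> - X1 t \<omega>) > e} \<le> e) \<and>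
        distr M (PiM J (\<lambda>_. borel)) (\<lambda>\<omega>. restrict (\<lambda>t. S1 t \<omega>) J) =
        distr M (PiM J (\<lambda>_. borel)) (\<lambda>\<omega>. restrict (\<lambda>t. S2 t \<omega>) J)"
        by (intro exI[of _ S2] exI[of _ S1]) auto
    qed
  qed
qed

text \<open>The filter reads only the finite index set L, the union of the K t, and is a measurable
  map between finite product spaces; equal laws on L are pushed forward.\<close>

lemma same_law_linear_image:
  fixes Z1 Z2 :: "(nat \<Rightarrow> int) \<Rightarrow> 'a \<Rightarrow> real^'n" and A :: "'i \<Rightarrow> (nat \<Rightarrow> int) \<Rightarrow> real^'n^'n"
  assumes Z: "same_law M N Z1 Z2"
    and Z1: "\<And>t. t \<in> ZN N \<Longrightarrow> Z1 t \<in> borel_measurable M"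
    and Z2: "\<And>t. t \<in> ZN N \<Longrightarrow> Z2 t \<in> borel_measurable M"
    and J: "finite J" and K: "\<And>t. t \<in> J \<Longrightarrow> finite (K t)" "\<And>t. t \<in> J \<Longrightarrow> K t \<subseteq> ZN N"
  shows "distr M (PiM J (\<lambda>_. borel)) (\<lambda>\<omega>. restrict (\<lambda>t. \<Sum>j\<in>K t. A t j *v Z1 j \<omega>) J) =
    distr M (PiM J (\<lambda>_. borel)) (\<lambda>\<omega>. restrict (\<lambda>t. \<Sum>j\<in>K t. A t j *v Z2 j \<omega>) J)"
proof -
  define L where "L = (\<Union>t\<in>J. K t)"
  have L: "finite L" "L \<subseteq> ZN N" using J K by (auto simp: L_def)
  define \<phi> where "\<phi> f = restrict (\<lambda>t. \<Sum>j\<in>K t. A t j *v f j) J" for f :: "(nat \<Rightarrow> int) \<Rightarrow> real^'n"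
  have \<phi>: "\<phi> \<in> PiM L (\<lambda>_. borel) \<rightarrow>\<^sub>M PiM J (\<lambda>_. borel)"
    unfolding \<phi>_def
  proof (intro measurable_restrict borel_measurable_sum borel_measurable_matrix_vector_mult)
    fix t j assume "t \<in> J" "j \<in> K t"
    then show "(\<lambda>f. f j) \<in> borel_measurable (PiM L (\<lambda>_. borel :: (real^'n) measure))"
      by (intro measurable_component_singleton) (auto simp: L_def)
  qed
  have *: "distr M (PiM J (\<lambda>_. borel)) (\<lambda>\<omega>. restrict (\<lambda>t. \<Sum>j\<in>K t. A t j *v Z j \<omega>) J) =
      distr (distr M (PiM L (\<lambda>_. borel)) (\<lambda>\<omega>. restrict (\<lambda>t. Z t \<omega>) L)) (PiM J (\<lambda>_. borel)) \<phi>"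
    if "\<And>t. t \<in> ZN N \<Longrightarrow> Z t \<in> borel_measurable M" for Z :: "(nat \<Rightarrow> int) \<Rightarrow> 'a \<Rightarrow> real^'n"
  proof -
    have "distr (distr M (PiM L (\<lambda>_. borel)) (\<lambda>\<omega>. restrict (\<lambda>t. Z t \<omega>) L)) (PiM J (\<lambda>_. borel)) \<phi> =
      distr M (PiM J (\<lambda>_. borel)) (\<phi> \<circ> (\<lambda>\<omega>. restrict (\<lambda>t. Z t \<omega>) L))"
      using that L by (intro distr_distr \<phi> measurable_restrict) auto
    also have "\<phi> \<circ> (\<lambda>\<omega>. restrict (\<lambda>t. Z t \<omega>) L) = (\<lambda>\<omega>. restrict (\<lambda>t. \<Sum>j\<in>K t. A t j *v Z j \<omega>) J)"
    proof (intro ext)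
      fix \<omega> t
      show "(\<phi> \<circ> (\<lambda>\<omega>. restrict (\<lambda>t. Z t \<omega>) L)) \<omega> t = restrict (\<lambda>t. \<Sum>j\<in>K t. A t j *v Z j \<omega>) J t"
        by (cases "t \<in> J") (auto simp: \<phi>_def L_def intro!: sum.cong)
    qed
    finally show ?thesis by (rule sym)
  qed
  have "distr M (PiM L (\<lambda>_. borel)) (\<lambda>\<omega>. restrict (\<lambda>t. Z1 t \<omega>) L) =
      distr M (PiM L (\<lambda>_. borel)) (\<lambda>\<omega>. restrict (\<lambda>t. Z2 t \<omega>) L)"
    using Z L unfolding same_law_def by blast
  then show ?thesis
    by (intro trans[OF *[OF Z1] trans[OF _ *[OF Z2, symmetric]]] arg_cong[of _ _ "\<lambda>D. distr D _ \<phi>"]) auto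
qed

end

section \<open>Stationary fields\<close>

lemma (in prob_space) same_law_marginal:
  assumes law: "same_law M N Z1 Z2" and t: "t \<in> ZN N"
    and Z: "Z1 t \<in> borel_measurable M" "Z2 t \<in> borel_measurable M" and B: "B \<in> sets borel"
  shows "prob (Z1 t -` B \<inter> space M) = prob (Z2 t -` B \<inter> space M)"
proof -
  let ?R = "(\<lambda>f. f t) -` B \<inter> space (PiM {t} (\<lambda>_. borel))"
  have R: "?R \<in> sets (PiM {t} (\<lambda>_. borel))"
    using B by (intro measurable_sets[OF measurable_component_singleton]) auto
  have *: "measure (distr M (PiM {t} (\<lambda>_. borel)) (\<lambda>\<omega>. restrict (\<lambda>t. Z t \<omega>) {t})) ?R = prob (Z t -` B \<inter> space M)"
    if "Z t \<in> borel_measurable M" for Z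
  proof -
    have "measure (distr M (PiM {t} (\<lambda>_. borel)) (\<lambda>\<omega>. restrict (\<lambda>t. Z t \<omega>) {t})) ?R =
        prob ((\<lambda>\<omega>. restrict (\<lambda>t. Z t \<omega>) {t}) -` ?R \<inter> space M)"
      using R that by (intro measure_distr measurable_restrict) auto
    also have "(\<lambda>\<omega>. restrict (\<lambda>t. Z t \<omega>) {t}) -` ?R \<inter> space M = Z t -` B \<inter> space M"
      by (auto simp: space_PiM)
    finally show ?thesis .
  qed
  have "distr M (PiM {t} (\<lambda>_. borel)) (\<lambda>\<omega>. restrict (\<lambda>t. Z1 t \<omega>) {t}) =
      distr M (PiM {t} (\<lambda>_. borel)) (\<lambda>\<omega>. restrict (\<lambda>t. Z2 t \<omega>) {t})"
    using law t unfolding same_law_def by blast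
  then show ?thesis using *[of Z1, OF Z(1)] *[of Z2, OF Z(2)] by simp
qed

text \<open>Tightness of one variable: the thresholds grow without bound because q > 1, so the
  events decrease to the empty set.\<close>

lemma (in prob_space) prob_norm_gt_geometric:
  fixes Z :: "'a \<Rightarrow> real^'n"
  assumes [measurable]: "Z \<in> borel_measurable M" and "0 < e" "1 < q"
  shows "(\<lambda>n. prob {\<omega>\<in>space M. norm (Z \<omega>) > e * q ^ n}) \<longlonglongrightarrow> 0"
proof -
  let ?A = "\<lambda>n. {\<omega>\<in>space M. norm (Z \<omega>) > e * q ^ n}"
  have "decseq ?A"
  proof (rule decseq_SucI, safe)
    fix n \<omega> assume "e * q ^ Suc n < norm (Z \<omega>)"
    moreover have "e * q ^ n \<le> e * q ^ Suc n"
      using assms by (intro mult_left_mono power_increasing) auto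
    ultimately show "e * q ^ n < norm (Z \<omega>)" by linarith
  qed
  moreover have "range ?A \<subseteq> events" by auto
  ultimately have "(\<lambda>n. prob (?A n)) \<longlonglongrightarrow> prob (\<Inter>n. ?A n)"
    by (intro finite_Lim_measure_decseq)
  also have "(\<Inter>n. ?A n) = {}"
  proof -
    have "\<exists>n. \<not> e * q ^ n < norm (Z \<omega>)" for \<omega>
    proof -
      obtain n where "norm (Z \<omega>) / e < q ^ n" using real_arch_pow[OF \<open>1 < q\<close>] by blast
      then have "\<not> e * q ^ n < norm (Z \<omega>)" using \<open>0 < e\<close> by (simp add: pos_divide_less_eq mult.commute)
      then show ?thesis ..
    qed
    then show ?thesis by blast
  qed
  finally show ?thesis by simp
qed

lemma ZN_add: "s \<in> ZN N \<Longrightarrow> t \<in> ZN N \<Longrightarrow> (\<lambda>k. t k + s k) \<in> ZN N"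
  by (simp add: ZN_def)

lemma ZN_diff: "s \<in> ZN N \<Longrightarrow> t \<in> ZN N \<Longrightarrow> (\<lambda>k. t k - s k) \<in> ZN N"
  by (simp add: ZN_def)

lemma filterlim_lower_cutoff: "filterlim (\<lambda>m::int. min (- m - 1) b) at_bot at_top"
  unfolding filterlim_at_bot
proof
  fix Z :: int
  show "\<forall>\<^sub>F m in at_top. min (- m - 1) b \<le> Z"
    using eventually_ge_at_top[of "- Z - 1"] by eventually_elim auto
qed

locale random_field_setup = prob_space M + commuting_matrices N \<Theta>
  for M :: "'a measure" and N :: nat and \<Theta> :: "nat \<Rightarrow> real^'n^'n"
begin

lemma Delta_measurable:
  assumes "\<And>t. t \<in> ZN N \<Longrightarrow> Z t \<in> borel_measurable M" "t \<in> ZN N"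
  shows "Delta N Z t \<in> borel_measurable M"
  unfolding Delta_def using assms cube_subset_ZN[of N]
  by (intro borel_measurable_sum borel_measurable_scaleR borel_measurable_const) (auto intro: ZN_diff)

lemma Lmap_measurable: "X t \<in> borel_measurable M \<Longrightarrow> Lmap N \<Theta> X t \<in> borel_measurable M"
  unfolding Lmap_def by (rule borel_measurable_matrix_vector_mult)

lemma Mmap_measurable:
  assumes "\<And>t. t \<in> ZN N \<Longrightarrow> Y t \<in> borel_measurable M"
  shows "Mmap N \<Theta> Y t \<in> borel_measurable M"
  unfolding Mmap_def
  by (intro borel_measurable_scaleR borel_measurable_const borel_measurable_sum
    borel_measurable_matrix_vector_mult Delta_measurable assms) (auto simp: mbox_def)

lemma cond_i_imp_vanishes:
  assumes "cond_i M N \<Theta> X"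
  shows "vanishes_at_bot N (Lmap N \<Theta> X)"
  unfolding vanishes_at_bot_def
proof safe
  fix l t assume l: "l < N" and t: "t \<in> ZN N"
  have "Lmap N \<Theta> X (t(l := m)) = (\<lambda>\<omega>. E (t(l := 0)) *v (mexp (of_int m *\<^sub>R \<Theta> l) *v X (t(l := m)) \<omega>))" for m
    by (intro ext) (unfold Lmap_eq, rule E_update[OF l])
  moreover have "conv_in_prob M (\<lambda>m \<omega>. mexp (of_int m *\<^sub>R \<Theta> l) *v X (t(l := m)) \<omega>) (\<lambda>_. 0) at_bot"
    using assms l t unfolding cond_i_def by blast
  ultimately show "conv_in_prob M (\<lambda>m. Lmap N \<Theta> X (t(l := m))) (\<lambda>_. 0) at_bot"
    by (simp only:) (rule conv_in_prob_matrix_mult_zero)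
qed

text \<open>In direction j the shifted field follows the line of X through t + s with argument m +
  s_j. The surplus factor e^(s_j \<Theta>_j) is removed by a fixed matrix, which preserves
  convergence to 0.\<close>

lemma cond_i_shift:
  assumes "cond_i M N \<Theta> X" and s: "s \<in> ZN N"
  shows "cond_i M N \<Theta> (\<lambda>t. X (\<lambda>k. t k + s k))"
  unfolding cond_i_def
proof (intro allI impI ballI)
  fix j t assume j: "j < N" and t: "t \<in> ZN N"
  let ?u = "\<lambda>k. t k + s k"
  have "conv_in_prob M (\<lambda>m \<omega>. mexp (of_int m *\<^sub>R \<Theta> j) *v X (?u(j := m)) \<omega>) (\<lambda>_. 0) at_bot"
    using assms(1) j ZN_add[OF s t] unfolding cond_i_def by blast
  moreover have "filterlim (\<lambda>m. m + s j) at_bot at_bot"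
    unfolding filterlim_at_bot
  proof
    fix Z show "\<forall>\<^sub>F m in at_bot. m + s j \<le> Z"
      using eventually_le_at_bot[of "Z - s j"] by eventually_elim simp
  qed
  ultimately have "conv_in_prob M (\<lambda>m \<omega>. mexp (of_int (m + s j) *\<^sub>R \<Theta> j) *v X (?u(j := m + s j)) \<omega>) (\<lambda>_. 0) at_bot"
    by (rule conv_in_prob_compose)
  then have "conv_in_prob M (\<lambda>m \<omega>. mexp (of_int (- s j) *\<^sub>R \<Theta> j) *v (mexp (of_int (m + s j) *\<^sub>R \<Theta> j) *v X (?u(j := m + s j)) \<omega>)) (\<lambda>_. 0) at_bot"
    by (rule conv_in_prob_matrix_mult_zero)
  moreover have "mexp (of_int (- s j) *\<^sub>R \<Theta> j) *v (mexp (of_int (m + s j) *\<^sub>R \<Theta> j) *v x) = mexp (of_int m *\<^sub>R \<Theta> j) *v x" for m x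
    unfolding mexp_coordinate[OF j] E_mult_vec by (rule arg_cong[of _ _ "\<lambda>u. E u *v x"]) auto
  moreover have "?u(j := m + s j) = (\<lambda>k. (t(j := m)) k + s k)" for m by auto
  ultimately show "conv_in_prob M (\<lambda>m \<omega>. mexp (of_int m *\<^sub>R \<Theta> j) *v X (\<lambda>k. (t(j := m)) k + s k) \<omega>) (\<lambda>_. 0) at_bot"
    by (simp only:)
qed

lemma innovation_shift: "innovation (\<lambda>t. X (\<lambda>k. t k + s k)) t = innovation X (\<lambda>k. t k + s k)"
  by (intro ext) (simp add: innovation_def algebra_simps)

text \<open>All variables on the line have one law, so the event |e^(m\<Theta>_j) X| > e, contained
  in |X| > e (1 + c)^n with n = -m, can be estimated by a tail probability of the fixed variable
  X_t.\<close>

lemma stationary_imp_cond_i: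
  assumes stat: "stationary M N X" and X: "\<And>t. t \<in> ZN N \<Longrightarrow> X t \<in> borel_measurable M"
    and sym: "\<And>j. j < N \<Longrightarrow> transpose (\<Theta> j) = \<Theta> j" and pos: "\<And>j. j < N \<Longrightarrow> pos_def (\<Theta> j)"
  shows "cond_i M N \<Theta> X"
  unfolding cond_i_def conv_in_prob_def
proof (intro allI impI ballI conjI)
  fix j t assume j: "j < N" and t: "t \<in> ZN N"
  note tm = ZN_update[OF t j]
  show "(\<lambda>\<omega>. mexp (of_int m *\<^sub>R \<Theta> j) *v X (t(j := m)) \<omega>) \<in> borel_measurable M" for m
    by (intro borel_measurable_matrix_vector_mult X tm)
  fix e :: real assume "0 < e"
  obtain c where c: "c > 0"
    "\<And>m x. (1 + c) ^ m * norm (mexp (of_int (- int m) *\<^sub>R \<Theta> j) *v x) \<le> norm x"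
    using E_negative_decay[OF j sym[OF j] pos[OF j]] by blast
  define p where "p n = prob {\<omega>\<in>space M. norm (X t \<omega>) > e * (1 + c) ^ n}" for n
  have "p \<longlonglongrightarrow> 0"
    unfolding p_def using \<open>0 < e\<close> c(1) X[OF t] by (intro prob_norm_gt_geometric) auto
  moreover have "filterlim (\<lambda>m::int. nat (- m)) sequentially at_bot"
    unfolding filterlim_at_top
  proof
    fix Z :: nat
    show "\<forall>\<^sub>F m in at_bot. Z \<le> nat (- m)"
      using eventually_le_at_bot[of "- int Z"] by eventually_elim auto
  qed
  ultimately have lim: "((\<lambda>m. p (nat (- m))) \<longlongrightarrow> 0) at_bot" by (rule filterlim_compose)
  show "((\<lambda>m. prob {\<omega>\<in>space M. dist (mexp (of_int m *\<^sub>R \<Theta> j) *v X (t(j := m)) \<omega>) 0 > e}) \<longlongrightarrow> 0) at_bot"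
  proof (rule tendsto_sandwich[OF _ _ tendsto_const lim])
    show "\<forall>\<^sub>F m in at_bot. prob {\<omega>\<in>space M. dist (mexp (of_int m *\<^sub>R \<Theta> j) *v X (t(j := m)) \<omega>) 0 > e} \<le> p (nat (- m))"
      using eventually_le_at_bot[of "0::int"]
    proof eventually_elim
      case (elim m)
      define n where "n = nat (- m)"
      have m: "m = - int n" using elim by (simp add: n_def)
      define s where "s k = (if k = j then m - t j else 0)" for k
      have s: "s \<in> ZN N" using j by (auto simp: ZN_def s_def)
      have ts: "(\<lambda>k. t k + s k) = t(j := m)" by (auto simp: s_def)
      note [measurable] = X[OF tm]
      have "prob {\<omega>\<in>space M. dist (mexp (of_int m *\<^sub>R \<Theta> j) *v X (t(j := m)) \<omega>) 0 > e}
          \<le> prob {\<omega>\<in>space M. norm (X (t(j := m)) \<omega>) > e * (1 + c) ^ n}"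
      proof (rule finite_measure_mono)
        show "{\<omega>\<in>space M. dist (mexp (of_int m *\<^sub>R \<Theta> j) *v X (t(j := m)) \<omega>) 0 > e}
          \<subseteq> {\<omega>\<in>space M. norm (X (t(j := m)) \<omega>) > e * (1 + c) ^ n}"
        proof safe
          fix \<omega> assume "e < dist (mexp (of_int m *\<^sub>R \<Theta> j) *v X (t(j := m)) \<omega>) 0"
          then have "e * (1 + c) ^ n < norm (mexp (of_int m *\<^sub>R \<Theta> j) *v X (t(j := m)) \<omega>) * (1 + c) ^ n"
            using c(1) by (intro mult_strict_right_mono) (simp_all del: fun_upd_apply)
          also have "\<dots> \<le> norm (X (t(j := m)) \<omega>)"
            using c(2)[of n "X (t(j := m)) \<omega>"] by (simp only: m mult.commute)
          finally show "e * (1 + c) ^ n < norm (X (t(j := m)) \<omega>)" .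
        qed
      qed measurable
      also have "\<dots> = prob (X (t(j := m)) -` {x. norm x > e * (1 + c) ^ n} \<inter> space M)"
        by (rule arg_cong[of _ _ prob]) auto
      also have "\<dots> = prob (X t -` {x. norm x > e * (1 + c) ^ n} \<inter> space M)"
      proof -
        have "same_law M N (\<lambda>t. X (\<lambda>k. t k + s k)) X" using stat s by (simp add: stationary_def)
        from same_law_marginal[OF this t, of "{x. norm x > e * (1 + c) ^ n}"] show ?thesis
          unfolding ts using X[OF tm] X[OF t] by simp
      qed
      also have "\<dots> = p n" unfolding p_def by (rule arg_cong[of _ _ prob]) auto
      finally show ?case by (simp add: n_def)
    qed
  qed simp
qed simp

section \<open>Box sums of innovations and recovery of the increment field\<close>

lemma AE_finite_sum_cong:
  assumes "finite K" "\<And>j. j \<in> K \<Longrightarrow> AE \<omega> in M. f j \<omega> = g j \<omega>"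
  shows "AE \<omega> in M. (\<Sum>j\<in>K. f j \<omega>) = (\<Sum>j\<in>K. g j \<omega>)"
proof -
  have "AE \<omega> in M. \<forall>j\<in>K. f j \<omega> = g j \<omega>" using assms by (intro AE_finite_allI)
  then show ?thesis by eventually_elim simp
qed

text \<open>D stands for any almost sure version of the innovations, so that the identity serves
  \<open>Delta N G\<close> and its shifts alike. A corner a not above t makes the orientation sign
  1.\<close>

lemma increment_sum_eq_corner_diff:
  assumes D: "\<And>t. t \<in> ZN N \<Longrightarrow> AE \<omega> in M. innovation X t \<omega> = D t \<omega>"
    and t: "t \<in> ZN N" and a: "\<And>l. l < N \<Longrightarrow> a l \<le> t l"
  shows "AE \<omega> in M. (\<Sum>j\<in>obox N a t. E j *v D j \<omega>) = corner_diff N a (\<lambda>j. Lmap N \<Theta> X j \<omega>) t"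
proof -
  have "AE \<omega> in M. (\<Sum>j\<in>obox N a t. Delta N (Lmap N \<Theta> X) j \<omega>) = (\<Sum>j\<in>obox N a t. E j *v D j \<omega>)"
  proof (rule AE_finite_sum_cong[OF finite_obox])
    fix j assume "j \<in> obox N a t"
    then have "AE \<omega> in M. innovation X j \<omega> = D j \<omega>" using obox_subset_ZN[OF t] by (intro D) auto
    then show "AE \<omega> in M. Delta N (Lmap N \<Theta> X) j \<omega> = E j *v D j \<omega>"
      by eventually_elim (simp add: Delta_Lmap)
  qed
  moreover have "(\<Sum>j\<in>obox N a t. Delta N (Lmap N \<Theta> X) j \<omega>) = corner_diff N a (\<lambda>j. Lmap N \<Theta> X j \<omega>) t" for \<omega>
  proof -
    have none: "{l. l < N \<and> t l < a l} = {}" using a by force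
    have "box_sum N a (\<lambda>j. Delta N (Lmap N \<Theta> X) j \<omega>) t = (\<Sum>j\<in>obox N a t. Delta N (Lmap N \<Theta> X) j \<omega>)"
      unfolding box_sum_eq_sum none by simp
    then show ?thesis unfolding box_sum_Delta by (rule sym)
  qed
  ultimately show ?thesis by (auto elim: eventually_mono)
qed

lemma Minv_rel_Lmap:
  assumes X: "\<And>t. t \<in> ZN N \<Longrightarrow> X t \<in> borel_measurable M"
    and i: "cond_i M N \<Theta> X" and ii: "cond_ii M N \<Theta> X G"
  shows "Minv_rel M N \<Theta> G (Lmap N \<Theta> X)"
  unfolding Minv_rel_def
proof
  fix t assume t: "t \<in> ZN N"
  let ?a = "\<lambda>Ms l. min (- Ms l - 1) (t l)"
  have "ilim M N (\<lambda>Ms \<omega>. corner_diff N (?a Ms) (\<lambda>j. Lmap N \<Theta> X j \<omega>) t) (Lmap N \<Theta> X t)"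
    using corner_diff_ilim[OF Lmap_measurable[OF X] cond_i_imp_vanishes[OF i] t, of 0 N
        "\<lambda>l m. min (- m - 1) (t l)"] filterlim_lower_cutoff by simp
  moreover have "AE \<omega> in M. corner_diff N (?a Ms) (\<lambda>j. Lmap N \<Theta> X j \<omega>) t = partsum N \<Theta> G t Ms \<omega>" for Ms
  proof -
    have "AE \<omega> in M. (\<Sum>j\<in>obox N (?a Ms) t. E j *v Delta N G j \<omega>) = corner_diff N (?a Ms) (\<lambda>j. Lmap N \<Theta> X j \<omega>) t"
      using ii by (intro increment_sum_eq_corner_diff t) (auto simp: cond_ii_iff)
    then show ?thesis
      by eventually_elim (simp add: partsum_def lowbox_eq_obox[OF t] E_def)
  qed
  ultimately show "ilim M N (partsum N \<Theta> G t) (Lmap N \<Theta> X t)" by (rule ilim_AE_cong)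
qed

text \<open>Every corner produced by replacing coordinates of t lies on an axis hyperplane and
  contributes 0 almost surely.\<close>

lemma corner_diff_zero_on_axes:
  assumes zero: "\<And>t. t \<in> ZN N \<Longrightarrow> \<exists>l<N. t l = 0 \<Longrightarrow> AE \<omega> in M. G t \<omega> = (0::real^'n)"
    and "k \<le> N" "t \<in> ZN N"
  shows "AE \<omega> in M. corner_diff k (\<lambda>_. 0) (\<lambda>j. G j \<omega>) t = G t \<omega>"
  using assms(2-)
proof (induction k arbitrary: t)
  case (Suc k)
  then have t0: "t(k := 0) \<in> ZN N" by (intro ZN_update) auto
  have "AE \<omega> in M. G (t(k := 0)) \<omega> = 0" using Suc.prems by (intro zero t0 exI[of _ k]) simp
  moreover have "AE \<omega> in M. corner_diff k (\<lambda>_. 0) (\<lambda>j. G j \<omega>) (t(k := 0)) = G (t(k := 0)) \<omega>"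
    using Suc t0 by simp
  moreover have "AE \<omega> in M. corner_diff k (\<lambda>_. 0) (\<lambda>j. G j \<omega>) t = G t \<omega>" using Suc by simp
  ultimately show ?case by eventually_elim (simp del: fun_upd_apply)
qed simp

text \<open>Summed from the axes, the innovations of X give \<open>Mmap\<close> of
  \<open>Lmap\<close> on the one hand and the telescoping sum of the increments of G on the other.
  The right-hand side does not involve G, whence uniqueness.\<close>

lemma increment_field_eq_Mmap:
  assumes ii: "cond_ii M N \<Theta> X G" and t: "t \<in> ZN N"
    and zero: "\<And>t. t \<in> ZN N \<Longrightarrow> \<exists>l<N. t l = 0 \<Longrightarrow> AE \<omega> in M. G t \<omega> = 0"
  shows "AE \<omega> in M. G t \<omega> = Mmap N \<Theta> (Lmap N \<Theta> X) t \<omega>"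
proof -
  have "AE \<omega> in M. (\<Sum>j\<in>obox N (\<lambda>_. 0) t. innovation X j \<omega>) = (\<Sum>j\<in>obox N (\<lambda>_. 0) t. Delta N G j \<omega>)"
    using ii obox_subset_ZN[OF t] by (intro AE_finite_sum_cong finite_obox) (auto simp: cond_ii_iff)
  then have "AE \<omega> in M. Mmap N \<Theta> (Lmap N \<Theta> X) t \<omega> = corner_diff N (\<lambda>_. 0) (\<lambda>j. G j \<omega>) t"
    by eventually_elim (simp add: Mmap_eq_box_sum[OF t] Delta_Lmap E_minus_E box_sum_eq_sum flip: box_sum_Delta)
  moreover have "AE \<omega> in M. corner_diff N (\<lambda>_. 0) (\<lambda>j. G j \<omega>) t = G t \<omega>"
    by (rule corner_diff_zero_on_axes[of G, OF zero order_refl t])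
  ultimately show ?thesis by eventually_elim simp
qed

text \<open>For a remote corner a, e^(-t*\<Theta>) times the box sum of e^(j*\<Theta>) D_j is close
  to X_t, and it is a linear filter of D with the same coefficients for both fields. Equality in law
  of D1 and D2 thus passes to the approximations and then to their limits.\<close>

lemma same_law_of_innovations:
  assumes X1: "\<And>t. t \<in> ZN N \<Longrightarrow> X1 t \<in> borel_measurable M" and X2: "\<And>t. t \<in> ZN N \<Longrightarrow> X2 t \<in> borel_measurable M"
    and D1: "\<And>t. t \<in> ZN N \<Longrightarrow> D1 t \<in> borel_measurable M" and D2: "\<And>t. t \<in> ZN N \<Longrightarrow> D2 t \<in> borel_measurable M"
    and v1: "cond_i M N \<Theta> X1" and v2: "cond_i M N \<Theta> X2"
    and eq1: "\<And>t. t \<in> ZN N \<Longrightarrow> AE \<omega> in M. innovation X1 t \<omega> = D1 t \<omega>"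
    and eq2: "\<And>t. t \<in> ZN N \<Longrightarrow> AE \<omega> in M. innovation X2 t \<omega> = D2 t \<omega>"
    and law: "same_law M N D1 D2"
  shows "same_law M N X1 X2"
  unfolding same_law_def
proof (intro allI impI, elim conjE)
  fix J :: "(nat \<Rightarrow> int) set" assume J: "finite J" "J \<subseteq> ZN N"
  show "distr M (PiM J (\<lambda>_. borel)) (\<lambda>\<omega>. restrict (\<lambda>t. X1 t \<omega>) J) =
    distr M (PiM J (\<lambda>_. borel)) (\<lambda>\<omega>. restrict (\<lambda>t. X2 t \<omega>) J)"
  proof (rule distr_eqI_approx[OF J(1)])
    show "X1 t \<in> borel_measurable M" "X2 t \<in> borel_measurable M" if "t \<in> J" for t
      using that J X1 X2 by auto
    fix e :: real assume e: "0 < e"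
    \<comment> \<open>\<open>\<kappa>\<close> dominates \<open>onorm\<close> plus 1 of
      e^(-t*\<Theta>) for all t in J at once, so that a tolerance e / \<open>\<kappa>\<close> for Y
      becomes the tolerance e after returning to X.\<close>
    define \<kappa> where "\<kappa> = (\<Sum>t\<in>J. onorm ((*v) (E (\<lambda>k. - t k)))) + 1"
    have \<kappa>: "onorm ((*v) (E (\<lambda>k. - t k))) + 1 \<le> \<kappa>" if "t \<in> J" for t
      unfolding \<kappa>_def using that J(1)
      by (intro add_right_mono member_le_sum[of t J "\<lambda>t. onorm ((*v) (E (\<lambda>k. - t k)))"] onorm_pos_le) auto
    have \<kappa>_pos: "0 < \<kappa>"
      unfolding \<kappa>_def by (intro add_nonneg_pos sum_nonneg onorm_pos_le) auto
    \<comment> \<open>At most every coordinate l < N of every t in J, so that one corner below b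
      gives positively oriented boxes for all of J.\<close>
    define b where "b = - (\<Sum>t\<in>J. \<Sum>l<N. \<bar>t l\<bar>)"
    have b: "b \<le> t l" if "t \<in> J" "l < N" for t l
    proof -
      have "\<bar>t l\<bar> \<le> (\<Sum>l<N. \<bar>t l\<bar>)" using that by (intro member_le_sum) auto
      also have "\<dots> \<le> (\<Sum>t\<in>J. \<Sum>l<N. \<bar>t l\<bar>)"
        using that J(1) by (intro member_le_sum[of t J "\<lambda>t. \<Sum>l<N. \<bar>t l\<bar>"] sum_nonneg) auto
      finally show ?thesis by (simp add: b_def)
    qed
    have "\<exists>a. (\<forall>l<N. a l \<le> b) \<and> (\<forall>Y\<in>{Lmap N \<Theta> X1, Lmap N \<Theta> X2}. \<forall>t\<in>J.
        prob {\<omega>\<in>space M. norm (corner_diff N a (\<lambda>j. Y j \<omega>) t - Y t \<omega>) > e / \<kappa>} < e)"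
      using J e \<kappa>_pos X1 X2 v1 v2
      by (intro corner_diff_approx) (auto intro: Lmap_measurable cond_i_imp_vanishes)
    then obtain a where a: "\<And>l. l < N \<Longrightarrow> a l \<le> b" "\<And>Y t. Y \<in> {Lmap N \<Theta> X1, Lmap N \<Theta> X2} \<Longrightarrow> t \<in> J \<Longrightarrow>
        prob {\<omega>\<in>space M. norm (corner_diff N a (\<lambda>j. Y j \<omega>) t - Y t \<omega>) > e / \<kappa>} < e"
      by blast
    define S where "S D t \<omega> = (\<Sum>j\<in>obox N a t. (E (\<lambda>k. - t k) ** E j) *v D j \<omega>)"
      for D :: "(nat \<Rightarrow> int) \<Rightarrow> 'a \<Rightarrow> real^'n" and t \<omega>
    have S_meas: "S D t \<in> borel_measurable M"
      if "\<And>t. t \<in> ZN N \<Longrightarrow> D t \<in> borel_measurable M" "t \<in> J" for D t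
      unfolding S_def[abs_def] using that J obox_subset_ZN[of t N a]
      by (intro borel_measurable_sum borel_measurable_matrix_vector_mult) auto
    have S_close: "prob {\<omega>\<in>space M. norm (S D t \<omega> - X t \<omega>) > e} \<le> e"
      if tJ: "t \<in> J" and X: "Lmap N \<Theta> X \<in> {Lmap N \<Theta> X1, Lmap N \<Theta> X2}" "\<And>t. t \<in> ZN N \<Longrightarrow> X t \<in> borel_measurable M"
        and D: "\<And>t. t \<in> ZN N \<Longrightarrow> AE \<omega> in M. innovation X t \<omega> = D t \<omega>"
               "\<And>t. t \<in> ZN N \<Longrightarrow> D t \<in> borel_measurable M" for t X D
    proof -
      have t: "t \<in> ZN N" using tJ J by auto
      define R where "R \<omega> = corner_diff N a (\<lambda>j. Lmap N \<Theta> X j \<omega>) t - Lmap N \<Theta> X t \<omega>" for \<omega>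
      have [measurable]: "R \<in> borel_measurable M" "S D t \<in> borel_measurable M" "X t \<in> borel_measurable M"
        unfolding R_def[abs_def]
        by (intro borel_measurable_diff corner_diff_measurable[OF Lmap_measurable[OF X(2)]] Lmap_measurable X(2) t order_refl
          S_meas[OF D(2) tJ] | assumption)+
      have "AE \<omega> in M. (\<Sum>j\<in>obox N a t. E j *v D j \<omega>) = corner_diff N a (\<lambda>j. Lmap N \<Theta> X j \<omega>) t"
        using a(1) b[OF tJ] by (intro increment_sum_eq_corner_diff D t) (auto intro: order_trans)
      then have "AE \<omega> in M. S D t \<omega> - X t \<omega> = E (\<lambda>k. - t k) *v R \<omega>"
      proof eventually_elim
        case (elim \<omega>)
        have "S D t \<omega> = E (\<lambda>k. - t k) *v (\<Sum>j\<in>obox N a t. E j *v D j \<omega>)"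
          unfolding S_def linear_sum[OF matrix_vector_mul_linear] by (simp add: matrix_vector_mul_assoc)
        moreover have "X t \<omega> = E (\<lambda>k. - t k) *v Lmap N \<Theta> X t \<omega>" by (simp add: Lmap_eq E_minus_E)
        ultimately show ?case
          unfolding R_def elim[symmetric] by (simp only: matrix_vector_mult_diff_distrib)
      qed
      then have "prob {\<omega>\<in>space M. norm (S D t \<omega> - X t \<omega>) > e} = prob {\<omega>\<in>space M. norm (E (\<lambda>k. - t k) *v R \<omega>) > e}"
        by (intro finite_measure_eq_AE) auto
      also have "\<dots> \<le> prob {\<omega>\<in>space M. norm (R \<omega>) > e / (onorm ((*v) (E (\<lambda>k. - t k))) + 1)}"
        by (rule prob_matrix_mult_le) measurable
      also have "\<dots> \<le> prob {\<omega>\<in>space M. norm (R \<omega>) > e / \<kappa>}"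
      proof (rule finite_measure_mono)
        have "e / \<kappa> \<le> e / (onorm ((*v) (E (\<lambda>k. - t k))) + 1)"
          using \<kappa>[OF tJ] e onorm_bound_pos(1)[of "E (\<lambda>k. - t k)"] by (intro divide_left_mono mult_pos_pos) auto
        then show "{\<omega>\<in>space M. norm (R \<omega>) > e / (onorm ((*v) (E (\<lambda>k. - t k))) + 1)} \<subseteq> {\<omega>\<in>space M. norm (R \<omega>) > e / \<kappa>}"
          by auto
      qed measurable
      also have "\<dots> < e" unfolding R_def by (rule a(2)[OF X(1) tJ])
      finally show ?thesis by simp
    qed
    have "\<forall>t\<in>J. S D1 t \<in> borel_measurable M \<and> S D2 t \<in> borel_measurable M \<and>
        prob {\<omega>\<in>space M. norm (S D1 t \<omega> - X1 t \<omega>) > e} \<le> e \<and> prob {\<omega>\<in>space M. norm (S D2 t \<omega> - X2 t \<omega>) > e} \<le> e"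
      by (intro ballI conjI S_meas[OF D1] S_meas[OF D2] S_close[OF _ _ X1 eq1 D1] S_close[OF _ _ X2 eq2 D2]) auto
    moreover have "distr M (PiM J (\<lambda>_. borel)) (\<lambda>\<omega>. restrict (\<lambda>t. S D1 t \<omega>) J) =
        distr M (PiM J (\<lambda>_. borel)) (\<lambda>\<omega>. restrict (\<lambda>t. S D2 t \<omega>) J)"
      unfolding S_def using J
      by (intro same_law_linear_image[OF law D1 D2 J(1)] finite_obox obox_subset_ZN) auto
    ultimately show "\<exists>S1 S2. (\<forall>t\<in>J. S1 t \<in> borel_measurable M \<and> S2 t \<in> borel_measurable M \<and>
        prob {\<omega>\<in>space M. norm (S1 t \<omega> - X1 t \<omega>) > e} \<le> e \<and> prob {\<omega>\<in>space M. norm (S2 t \<omega> - X2 t \<omega>) > e} \<le> e) \<and>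
        distr M (PiM J (\<lambda>_. borel)) (\<lambda>\<omega>. restrict (\<lambda>t. S1 t \<omega>) J) =
        distr M (PiM J (\<lambda>_. borel)) (\<lambda>\<omega>. restrict (\<lambda>t. S2 t \<omega>) J)" by blast
  qed
qed

lemma cond_imp_stationary:
  assumes X: "\<And>t. t \<in> ZN N \<Longrightarrow> X t \<in> borel_measurable M"
    and i: "cond_i M N \<Theta> X" and ii: "cond_ii M N \<Theta> X G"
    and G: "\<And>t. t \<in> ZN N \<Longrightarrow> G t \<in> borel_measurable M" and incr: "stat_incr M N G"
  shows "stationary M N X"
  unfolding stationary_def
proof
  fix s assume s: "s \<in> ZN N"
  show "same_law M N (\<lambda>t. X (\<lambda>k. t k + s k)) X"
  proof (rule same_law_of_innovations)
    show "same_law M N (\<lambda>t. Delta N G (\<lambda>k. t k + s k)) (Delta N G)"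
      using incr s by (simp add: stat_incr_def)
    show "AE \<omega> in M. innovation (\<lambda>t. X (\<lambda>k. t k + s k)) t \<omega> = Delta N G (\<lambda>k. t k + s k) \<omega>" if "t \<in> ZN N" for t
      using ii ZN_add[OF s that] by (simp add: cond_ii_iff innovation_shift)
    show "AE \<omega> in M. innovation X t \<omega> = Delta N G t \<omega>" if "t \<in> ZN N" for t
      using ii that by (simp add: cond_ii_iff)
  qed (auto intro: X Delta_measurable[OF G] ZN_add[OF s] cond_i_shift[OF i s] i)
qed

lemma innovation_same_law:
  assumes X: "\<And>t. t \<in> ZN N \<Longrightarrow> X t \<in> borel_measurable M"
    and law: "same_law M N X' X" and X': "\<And>t. t \<in> ZN N \<Longrightarrow> X' t \<in> borel_measurable M"
  shows "same_law M N (innovation X') (innovation X)"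
  unfolding same_law_def
proof (intro allI impI, elim conjE)
  fix J :: "(nat \<Rightarrow> int) set" assume J: "finite J" "J \<subseteq> ZN N"
  \<comment> \<open>Reindexing by j = t - i turns the innovation into a filter over finitely many
    indices with matrix coefficients.\<close>
  define K where "K t = (\<lambda>i k. t k - i k) ` cube N" for t :: "nat \<Rightarrow> int"
  define A where "A t j = ((-1::real) ^ nat (\<Sum>k<N. t k - j k)) *\<^sub>R E (\<lambda>k. - (t k - j k))" for t j
  have *: "innovation Z t \<omega> = (\<Sum>j\<in>K t. A t j *v Z j \<omega>)" for Z :: "(nat \<Rightarrow> int) \<Rightarrow> 'a \<Rightarrow> real^'n" and t \<omega>
  proof -
    have "inj_on (\<lambda>i k. t k - i k) (cube N)" by (rule inj_onI) (auto simp: fun_eq_iff)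
    then have "(\<Sum>j\<in>K t. A t j *v Z j \<omega>) = (\<Sum>i\<in>cube N. A t (\<lambda>k. t k - i k) *v Z (\<lambda>k. t k - i k) \<omega>)"
      unfolding K_def by (simp add: sum.reindex)
    also have "\<dots> = innovation Z t \<omega>"
      by (simp add: A_def innovation_def scaleR_matrix_vector_assoc)
    finally show ?thesis by (rule sym)
  qed
  show "distr M (PiM J (\<lambda>_. borel)) (\<lambda>\<omega>. restrict (\<lambda>t. innovation X' t \<omega>) J) =
     distr M (PiM J (\<lambda>_. borel)) (\<lambda>\<omega>. restrict (\<lambda>t. innovation X t \<omega>) J)"
    unfolding *
  proof (rule same_law_linear_image[OF law X' X J(1)])
    show "finite (K t)" for t by (simp add: K_def finite_cube)
    show "K t \<subseteq> ZN N" if "t \<in> J" for t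
      using that J cube_subset_ZN[of N] by (auto simp: K_def intro!: ZN_diff)
  qed
qed

lemma same_law_cong:
  assumes "\<And>t. t \<in> ZN N \<Longrightarrow> Z1 t = W1 t" "\<And>t. t \<in> ZN N \<Longrightarrow> Z2 t = W2 t" "same_law M N W1 W2"
  shows "same_law M N Z1 Z2"
  unfolding same_law_def
proof (intro allI impI, elim conjE)
  fix J :: "(nat \<Rightarrow> int) set" assume J: "finite J" "J \<subseteq> ZN N"
  have "(\<lambda>\<omega>. restrict (\<lambda>t. Z1 t \<omega>) J) = (\<lambda>\<omega>. restrict (\<lambda>t. W1 t \<omega>) J)"
    "(\<lambda>\<omega>. restrict (\<lambda>t. Z2 t \<omega>) J) = (\<lambda>\<omega>. restrict (\<lambda>t. W2 t \<omega>) J)"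
    using assms(1,2) J by (auto intro!: ext simp: restrict_def)
  then show "distr M (PiM J (\<lambda>_. borel)) (\<lambda>\<omega>. restrict (\<lambda>t. Z1 t \<omega>) J) =
     distr M (PiM J (\<lambda>_. borel)) (\<lambda>\<omega>. restrict (\<lambda>t. Z2 t \<omega>) J)"
    using assms(3) J unfolding same_law_def by (simp only:)
qed

text \<open>The field read off from \<open>Mmap\<close> is the witness: its increments are the
  innovations of X, which inherit stationarity, and convergence of its partial sums is the corner
  limit for \<open>Lmap\<close>.\<close>

lemma stationary_imp_inG0:
  assumes X: "\<And>t. t \<in> ZN N \<Longrightarrow> X t \<in> borel_measurable M"
    and stat: "stationary M N X" and i: "cond_i M N \<Theta> X"
  defines "G \<equiv> Mmap N \<Theta> (Lmap N \<Theta> X)"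
  shows "inG0 M N \<Theta> G" "cond_ii M N \<Theta> X G"
proof -
  have D: "Delta N G t = innovation X t" if "t \<in> ZN N" for t
    using Delta_Mmap_Lmap[OF that] by (intro ext) (simp add: G_def)
  show ii: "cond_ii M N \<Theta> X G"
    unfolding cond_ii_iff by (simp add: D)
  have "stat_incr M N G"
    unfolding stat_incr_def
  proof
    fix s assume s: "s \<in> ZN N"
    have "same_law M N (innovation (\<lambda>t. X (\<lambda>k. t k + s k))) (innovation X)"
      using stat s by (intro innovation_same_law X) (auto simp: stationary_def intro: X ZN_add[OF s])
    then show "same_law M N (\<lambda>t. Delta N G (\<lambda>k. t k + s k)) (\<lambda>t. Delta N G t)"
      by (rule same_law_cong[rotated 2]) (simp_all add: D ZN_add[OF s] innovation_shift)
  qed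
  moreover have "G t \<in> borel_measurable M" for t
    unfolding G_def by (intro Mmap_measurable Lmap_measurable X)
  \<comment> \<open>On the axes the box requires 1 <= j_l <= 0 and is empty, so G vanishes surely
    there.\<close>
  moreover have "G t \<omega> = 0" if "l < N" "t l = 0" for t l \<omega>
  proof -
    have "mbox N t = {}" using that by (auto simp: mbox_def)
    then show ?thesis by (simp add: G_def Mmap_def)
  qed
  ultimately show "inG0 M N \<Theta> G"
    using Minv_rel_Lmap[OF X i ii] unfolding inG0_def inG_def Minv_rel_def by auto
qed

end

theorem mainTheorem12:
  fixes M :: "'a measure" and N :: nat
    and \<Theta> :: "nat \<Rightarrow> real^'n^'n"
    and X :: "(nat \<Rightarrow> int) \<Rightarrow> 'a \<Rightarrow> real^'n"
  assumes "prob_space M" and "1 \<le> N"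
    and "\<forall>j<N. transpose (\<Theta> j) = \<Theta> j"
    and "\<forall>j<N. pos_def (\<Theta> j)"
    and "\<forall>j<N. \<forall>k<N. \<Theta> j ** \<Theta> k = \<Theta> k ** \<Theta> j"
    and "\<forall>t\<in>ZN N. X t \<in> borel_measurable M"
  shows "(stationary M N X \<longleftrightarrow>
            (cond_i M N \<Theta> X \<and> (\<exists>G. inG0 M N \<Theta> G \<and> cond_ii M N \<Theta> X G)))
       \<and> (stationary M N X \<longrightarrow>
            (\<forall>G G'. inG0 M N \<Theta> G \<and> cond_ii M N \<Theta> X G \<and> inG0 M N \<Theta> G' \<and> cond_ii M N \<Theta> X G'
                 \<longrightarrow> (\<forall>t\<in>ZN N. AE \<omega> in M. G t \<omega> = G' t \<omega>))
          \<and> (\<forall>G. inG0 M N \<Theta> G \<and> cond_ii M N \<Theta> X G \<longrightarrow>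
                 Minv_rel M N \<Theta> G (Lmap N \<Theta> X)
               \<and> (\<forall>t\<in>ZN N. AE \<omega> in M. G t \<omega> = Mmap N \<Theta> (Lmap N \<Theta> X) t \<omega>)))"
proof -
  interpret prob_space M by fact
  interpret random_field_setup M N \<Theta> by unfold_locales (use assms(5) in blast)
  have X: "X t \<in> borel_measurable M" if "t \<in> ZN N" for t using assms(6) that by blast
  have cond_i: "cond_i M N \<Theta> X" if "stationary M N X"
    using assms(3,4) by (intro stationary_imp_cond_i that X) auto
  have Mmap: "AE \<omega> in M. G t \<omega> = Mmap N \<Theta> (Lmap N \<Theta> X) t \<omega>"
    if "inG0 M N \<Theta> G" "cond_ii M N \<Theta> X G" "t \<in> ZN N" for G t
    using that by (intro increment_field_eq_Mmap) (auto simp: inG0_def)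
  have unique: "AE \<omega> in M. G t \<omega> = G' t \<omega>"
    if "inG0 M N \<Theta> G" "cond_ii M N \<Theta> X G" "inG0 M N \<Theta> G'" "cond_ii M N \<Theta> X G'" "t \<in> ZN N" for G G' t
    using Mmap[OF that(1,2,5)] Mmap[OF that(3,4,5)] by eventually_elim simp
  have "stationary M N X" if "cond_i M N \<Theta> X" "inG0 M N \<Theta> G" "cond_ii M N \<Theta> X G" for G
    using that by (intro cond_imp_stationary[of X G] X) (auto simp: inG0_def inG_def)
  moreover have "\<exists>G. inG0 M N \<Theta> G \<and> cond_ii M N \<Theta> X G" if "stationary M N X"
    using stationary_imp_inG0[OF X that cond_i[OF that]] by blast
  moreover have "Minv_rel M N \<Theta> G (Lmap N \<Theta> X)" if "stationary M N X" "cond_ii M N \<Theta> X G" for G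
    using that by (intro Minv_rel_Lmap X cond_i)
  ultimately show ?thesis using cond_i Mmap unique by blast
qed

end
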